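(* Let $p\ge3$ be a prime number and let $q$ be a prime satisfying $q\equiv1\pmod{2p(p-1)}$. Let $G=Q_{4p}\times Q_{4(p-1)}\times C_{\mathrm{rad}(p-1)/2}$, and define $x=(-1,1,c_{\mathrm{rad}(p-1)/2})$ and $y=(1,-1,c_{\mathrm{rad}(p-1)/2})$ in $G$. Then there exists an embedding of $G$ into the symmetric group $\mathfrak{S}_{q^4}$ such that $(G,\mathfrak{S}_{q^4})$ satisfies the property $\mathcal{Q}(2p;x,y)$. If $p$ is a Sophie Germain prime (i.e. $2p+1$ is also prime) and $q'$ is a prime satisfying $q'\equiv1\pmod{4p(2p+1)}$, then there exists an embedding of $G':=Q_{4(2p+1)}\times Q_{8p}$ into $\mathfrak{S}_{(q')^4}$ such that $(G',\mathfrak{S}_{(q')^4})$ satisfies the property $\mathcal{Q}(2p;(1,-1),(-1,1))$.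
   Context: $C_n$ is the cyclic group of $n$-th roots of unity in $\mathbb{C}$, with generator $c_n=\exp(2\pi i/n)$. $\mathrm{rad}(n)$ is the product of the distinct primes dividing $n$. For $n\ge2$, $Q_{4n}=\langle a,u\mid a^{2n}=1,\ a^n=u^2,\ uau^{-1}=a^{-1}\rangle$ is the generalized quaternion group of order $4n$, and $-1$ denotes its unique element of order $2$. For a finite group $\Gamma$ and $\ell\ge1$: $f_\ell^\Gamma(x)=x^\ell$, $r_\ell^\Gamma(g)=\#\{h\in\Gamma:h^\ell=g\}$, $\langle f,g\rangle_\Gamma=\frac1{|\Gamma|}\sum_{x\in\Gamma}f(x)\overline{g(x)}$. For $\Gamma\subset N$, $(\mathrm{Ind}_\Gamma^Ng)(a)=\frac1{|\Gamma|}\sum_{b\in N,\ b^{-1}ab\in\Gamma}g(b^{-1}ab)$. With $\mathcal{S}$ the set of positive squarefree integers and $g$ a real class function on $\Gamma$: $\iota^N(g)=\min\{\ell\in\mathcal{S}:\mathrm{Ind}_\Gamma^N(g\circ f_\ell^\Gamma)\ne0\}$, $\gamma(g)=\min\{\ell\in\mathcal{S}:\langle g,r_\ell^\Gamma\rangle_\Gamma\ne0\}$, $\min\emptyset=\infty$. For conjugacy classes $C_1,C_2$ of $\Gamma$, $t_{C_1,C_2}=\frac{|\Gamma|}{|C_1|}\mathbf{1}_{C_1}-\frac{|\Gamma|}{|C_2|}\mathbf{1}_{C_2}$. Property $\mathcal{P}(d;x,y)$ ($d$ positive squarefree): $x,y\in G$ have the same order, $r_\ell^G(x)=r_\ell^G(y)$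 for all squarefree $\ell<d$, and $r_d^G(x)<r_d^G(y)$. Property $\mathcal{Q}(2d;x,y)$ ($d\ge3$ odd squarefree): a pair $(G,G^+)$ of finite groups $G\subset G^+$ satisfies $\mathcal{Q}(2d;x,y)$ if $G$ satisfies $\mathcal{P}(2d;x,y)$ and, with $C_x,C_y$ the conjugacy classes of $x,y$ in $G$, $\gamma(t_{C_x,C_y})=2\iota^{G^+}(t_{C_x,C_y})$. *)

theory Defs
  imports
    "HOL-Library.Extended_Nat"
    "HOL-Library.Indicator_Function"
    "HOL-Number_Theory.Number_Theory"
    "HOL-Computational_Algebra.Squarefree"
    "HOL-Algebra.Sym_Groups"
    "HOL-Algebra.Multiplicative_Group"
begin

text \<open>A word is a list of letters, where \<^term>\<open>(g, True)\<close> stands for the generator \<open>g\<close> and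
  \<^term>\<open>(g, False)\<close> for its inverse. A set \<open>R\<close> of pairs of words is read as the set of defining
  relations \<open>v = w\<close> for \<open>(v, w)\<close> in \<open>R\<close>.\<close>

type_synonym 'g word = "('g \<times> bool) list"

inductive word_eq :: "('g word \<times> 'g word) set \<Rightarrow> 'g word \<Rightarrow> 'g word \<Rightarrow> bool"
  for R :: "('g word \<times> 'g word) set" where
  rel: "(v, w) \<in> R \<Longrightarrow> word_eq R v w"
| cancel: "word_eq R [(g, e), (g, \<not> e)] []"
| refl: "word_eq R v v"
| sym: "word_eq R v w \<Longrightarrow> word_eq R w v"
| trans: "word_eq R v w \<Longrightarrow> word_eq R w z \<Longrightarrow> word_eq R v z"
| append: "word_eq R v v' \<Longrightarrow> word_eq R w w' \<Longrightarrow> word_eq R (v @ w) (v' @ w')"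

definition word_class :: "('g word \<times> 'g word) set \<Rightarrow> 'g word \<Rightarrow> 'g word set" where
  "word_class R v = {w. word_eq R v w}"

definition presented_group :: "('g word \<times> 'g word) set \<Rightarrow> 'g word set monoid" where
  "presented_group R =
    \<lparr>carrier = range (word_class R),
     mult = (\<lambda>S T. \<Union>v\<in>S. \<Union>w\<in>T. word_class R (v @ w)),
     one = word_class R []\<rparr>"

lemma word_class_eq_iff: "word_class R v = word_class R w \<longleftrightarrow> word_eq R v w"
  unfolding word_class_def by (blast intro: word_eq.refl word_eq.sym word_eq.trans)

lemma presented_group_mult:
  "word_class R v \<otimes>\<^bsub>presented_group R\<^esub> word_class R w = word_class R (v @ w)"
proof -
  have "word_class R (v' @ w') = word_class R (v @ w)"
    if "v' \<in> word_class R v" "w' \<in> word_class R w" for v' w'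
    using that unfolding word_class_eq_iff
    by (auto simp: word_class_def intro: word_eq.sym word_eq.append)
  moreover have "v \<in> word_class R v" "w \<in> word_class R w"
    by (simp_all add: word_class_def word_eq.refl)
  ultimately have "(\<Union>v'\<in>word_class R v. \<Union>w'\<in>word_class R w. word_class R (v' @ w')) =
      word_class R (v @ w)"
    by blast
  then show ?thesis
    by (simp add: presented_group_def)
qed

lemma word_eq_left_inverse: "\<exists>w. word_eq R (w @ v) []"
proof (induction v)
  case Nil
  show ?case using word_eq.refl by force
next
  case (Cons l v)
  obtain g e where l: "l = (g, e)" by force
  from Cons obtain w where w: "word_eq R (w @ v) []" by blast
  have "word_eq R [(g, \<not> e), (g, e)] []"
    using word_eq.cancel[of R g "\<not> e"] by simp
  then have "word_eq R (w @ ([(g, \<not> e), (g, e)] @ v)) (w @ ([] @ v))"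
    by (intro word_eq.append word_eq.refl)
  with w have "word_eq R ((w @ [(g, \<not> e)]) @ (l # v)) []"
    by (auto simp: l intro: word_eq.trans)
  then show ?case by blast
qed

lemma group_presented_group: "group (presented_group R)"
proof (rule groupI)
  have carrier: "S \<in> carrier (presented_group R) \<longleftrightarrow> (\<exists>v. S = word_class R v)" for S
    by (auto simp: presented_group_def)
  have one: "\<one>\<^bsub>presented_group R\<^esub> = word_class R []"
    by (simp add: presented_group_def)
  show "S \<otimes>\<^bsub>presented_group R\<^esub> T \<in> carrier (presented_group R)"
    if "S \<in> carrier (presented_group R)" "T \<in> carrier (presented_group R)" for S T
    using that unfolding carrier by (auto simp: presented_group_mult)
  show "\<one>\<^bsub>presented_group R\<^esub> \<in> carrier (presented_group R)"
    unfolding carrier one by blast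
  show "S \<otimes>\<^bsub>presented_group R\<^esub> T \<otimes>\<^bsub>presented_group R\<^esub> V =
      S \<otimes>\<^bsub>presented_group R\<^esub> (T \<otimes>\<^bsub>presented_group R\<^esub> V)"
    if "S \<in> carrier (presented_group R)" "T \<in> carrier (presented_group R)"
      "V \<in> carrier (presented_group R)" for S T V
    using that unfolding carrier by (auto simp: presented_group_mult)
  show "\<one>\<^bsub>presented_group R\<^esub> \<otimes>\<^bsub>presented_group R\<^esub> S = S"
    if "S \<in> carrier (presented_group R)" for S
    using that unfolding carrier one by (auto simp: presented_group_mult)
  show "\<exists>T\<in>carrier (presented_group R). T \<otimes>\<^bsub>presented_group R\<^esub> S = \<one>\<^bsub>presented_group R\<^esub>"
    if S: "S \<in> carrier (presented_group R)" for S
  proof -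
    obtain v where v: "S = word_class R v"
      using S unfolding carrier by blast
    obtain w where "word_eq R (w @ v) []"
      using word_eq_left_inverse by blast
    then have "word_class R w \<otimes>\<^bsub>presented_group R\<^esub> S = \<one>\<^bsub>presented_group R\<^esub>"
      unfolding v one presented_group_mult word_class_eq_iff .
    moreover have "word_class R w \<in> carrier (presented_group R)"
      unfolding carrier by blast
    ultimately show ?thesis by blast
  qed
qed

datatype quat_gen = A | U

text \<open>\<open>gen_quat n\<close> is \<open>Q\<^bsub>4n\<^esub> = \<langle>a, u | a\<^sup>2\<^sup>n = 1, a\<^sup>n = u\<^sup>2, u a u\<^sup>-\<^sup>1 = a\<^sup>-\<^sup>1\<rangle>\<close>: the index is a
  quarter of the order.\<close>

definition gen_quat :: "nat \<Rightarrow> quat_gen word set monoid" where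
  "gen_quat n = presented_group
    {(replicate (2 * n) (A, True), []),
     (replicate n (A, True), replicate 2 (U, True)),
     ([(U, True), (A, True), (U, False)], [(A, False)])}"

definition minus_one :: "nat \<Rightarrow> quat_gen word set" where
  "minus_one n = (THE z. z \<in> carrier (gen_quat n) \<and> group.ord (gen_quat n) z = 2)"

definition cyc :: "nat \<Rightarrow> complex monoid" where
  "cyc n = \<lparr>carrier = {z. z ^ n = 1}, mult = (*), one = 1\<rparr>"

definition cyc_gen :: "nat \<Rightarrow> complex" where
  "cyc_gen n = exp (2 * of_real pi * \<i> / of_nat n)"

definition rad :: "nat \<Rightarrow> nat" where
  "rad n = \<Prod>(prime_factors n)"

definition root_count :: "('a, 'b) monoid_scheme \<Rightarrow> nat \<Rightarrow> 'a \<Rightarrow> nat" where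
  "root_count \<Gamma> l g = card {h \<in> carrier \<Gamma>. h [^]\<^bsub>\<Gamma>\<^esub> l = g}"

definition class_inner :: "('a, 'b) monoid_scheme \<Rightarrow> ('a \<Rightarrow> complex) \<Rightarrow> ('a \<Rightarrow> complex) \<Rightarrow> complex" where
  "class_inner \<Gamma> f g = 1 / of_nat (order \<Gamma>) * (\<Sum>x\<in>carrier \<Gamma>. f x * cnj (g x))"

definition induced ::
    "('a, 'b) monoid_scheme \<Rightarrow> ('a, 'c) monoid_scheme \<Rightarrow> ('a \<Rightarrow> complex) \<Rightarrow> 'a \<Rightarrow> complex" where
  "induced \<Gamma> N g a = 1 / of_nat (order \<Gamma>) *
     (\<Sum>b | b \<in> carrier N \<and> inv\<^bsub>N\<^esub> b \<otimes>\<^bsub>N\<^esub> a \<otimes>\<^bsub>N\<^esub> b \<in> carrier \<Gamma>. g (inv\<^bsub>N\<^esub> b \<otimes>\<^bsub>N\<^esub> a \<otimes>\<^bsub>N\<^esub> b))"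

text \<open>The infimum of a set of extended naturals is its minimum, and \<open>\<infinity>\<close> for the empty set. Nonvanishing of
  an induced function is nonvanishing on the carrier of the big group.\<close>

definition iota :: "('a, 'b) monoid_scheme \<Rightarrow> ('a, 'c) monoid_scheme \<Rightarrow> ('a \<Rightarrow> real) \<Rightarrow> enat" where
  "iota \<Gamma> N g = Inf (enat ` {l. 0 < l \<and> squarefree l \<and>
     (\<exists>a\<in>carrier N. induced \<Gamma> N (\<lambda>h. of_real (g (h [^]\<^bsub>\<Gamma>\<^esub> l))) a \<noteq> 0)})"

definition gamma_inv :: "('a, 'b) monoid_scheme \<Rightarrow> ('a \<Rightarrow> real) \<Rightarrow> enat" where
  "gamma_inv \<Gamma> g = Inf (enat ` {l. 0 < l \<and> squarefree l \<and>
     class_inner \<Gamma> (\<lambda>h. of_real (g h)) (\<lambda>h. of_nat (root_count \<Gamma> l h)) \<noteq> 0})"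

definition conj_class :: "('a, 'b) monoid_scheme \<Rightarrow> 'a \<Rightarrow> 'a set" where
  "conj_class \<Gamma> x = {g \<otimes>\<^bsub>\<Gamma>\<^esub> x \<otimes>\<^bsub>\<Gamma>\<^esub> inv\<^bsub>\<Gamma>\<^esub> g |g. g \<in> carrier \<Gamma>}"

definition class_diff :: "('a, 'b) monoid_scheme \<Rightarrow> 'a set \<Rightarrow> 'a set \<Rightarrow> 'a \<Rightarrow> real" where
  "class_diff \<Gamma> C1 C2 g =
     of_nat (order \<Gamma>) / of_nat (card C1) * indicator C1 g -
     of_nat (order \<Gamma>) / of_nat (card C2) * indicator C2 g"

definition property_P :: "('a, 'b) monoid_scheme \<Rightarrow> nat \<Rightarrow> 'a \<Rightarrow> 'a \<Rightarrow> bool" where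
  "property_P G d x y \<longleftrightarrow>
     group G \<and> finite (carrier G) \<and> 0 < d \<and> squarefree d \<and>
     x \<in> carrier G \<and> y \<in> carrier G \<and> group.ord G x = group.ord G y \<and>
     (\<forall>l. 0 < l \<and> squarefree l \<and> l < d \<longrightarrow> root_count G l x = root_count G l y) \<and>
     root_count G d x < root_count G d y"

text \<open>The group \<open>G\<close> of a pair \<open>(G, G\<^sup>+)\<close> is a subgroup of \<open>G\<^sup>+\<close>, given by its underlying set \<open>H\<close>.\<close>

definition property_Q :: "'a set \<Rightarrow> ('a, 'b) monoid_scheme \<Rightarrow> nat \<Rightarrow> 'a \<Rightarrow> 'a \<Rightarrow> bool" where
  "property_Q H N m x y \<longleftrightarrow>
     group N \<and> finite (carrier N) \<and> subgroup H N \<and>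
     (\<exists>d. 3 \<le> d \<and> odd d \<and> squarefree d \<and> m = 2 * d) \<and>
     (let G = N\<lparr>carrier := H\<rparr>; t = class_diff G (conj_class G x) (conj_class G y)
      in property_P G m x y \<and> gamma_inv G t = 2 * iota G N t)"

end

theory Submission
  imports Defs
begin

text \<open>
  In each part \<open>x\<close> and \<open>y\<close> are central, with entries \<open>-1\<close> and \<open>1\<close> exchanged between two quaternion groups
  and an equal entry \<open>c\<close>, a generator, in a cyclic group (trivial in the second part). For central elements both
  invariants count roots: \<open>\<gamma>(t)\<close> is the least squarefree \<open>l\<close> for which \<open>x\<close> and \<open>y\<close> have different numbers of
  \<open>l\<close>-th roots, and \<open>\<iota>(t)\<close> is the least one for which these numbers differ inside some conjugacy class
  of the symmetric group (\<open>property_Q_criterion\<close>).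

  The root counts rest on one fact about \<open>Q\<^bsub>4n\<^esub>\<close>: outside the cyclic subgroup \<open>\<langle>a\<rangle>\<close> every element squares to
  \<open>-1\<close>. For odd \<open>l\<close> the central elements \<open>1\<close> and \<open>-1\<close> have equally many \<open>l\<close>-th roots, so only even \<open>l\<close> can separate
  \<open>x\<close> from \<open>y\<close>. The numbers of square roots of \<open>-1\<close> in the two quaternion groups agree because their parameters are
  consecutive integers, the odd one larger. In the first part, exponents that share an odd prime factor with \<open>p - 1\<close>
  are excluded by the cyclic factor, as then \<open>c\<close> has no roots. This leaves \<open>2p\<close> as the first difference, where \<open>1\<close>
  gains roots from the cyclic subgroup of the quaternion group whose parameter is divisible by \<open>p\<close>.

  The embedding can be chosen freely, and instead of a linear action on a four-dimensional space over a finite field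
  the proof takes translations: \<open>G \<times> H \<times> K\<close> acts on two copies of \<open>G \<times> H\<close>, through \<open>G\<close> on the first and through
  \<open>H\<close> on the second, and on \<open>K\<close>, with the remaining points fixed. Translations by elements of equal order are
  conjugate (\<open>swap_cyclic_actions\<close>), so the roots of \<open>x\<close> and \<open>y\<close> match up to conjugacy for \<open>l < p\<close>. For \<open>l = p\<close> the
  matching breaks, although the numbers of roots still agree: \<open>(-v, 1, z)\<close> with \<open>v\<close> of order \<open>p\<close> fixes a whole copy
  of \<open>G \<times> H\<close>, whereas every \<open>p\<close>-th root of \<open>y\<close> either moves all points of both copies or has a square that fixes both.

  What remains is to know the presented group: \<open>generalized_quaternion_gen_quat\<close> finds the normal forms
  \<open>a\<^sup>iu\<^sup>e\<close> from the relations, and their distinctness from a faithful representation by complex matrices.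
\<close>

section \<open>Central elements, roots and conjugacy\<close>

definition roots :: "('a, 'b) monoid_scheme \<Rightarrow> nat \<Rightarrow> 'a \<Rightarrow> 'a set" where
  "roots \<Gamma> l g = {h \<in> carrier \<Gamma>. h [^]\<^bsub>\<Gamma>\<^esub> l = g}"

lemma root_count_eq_card_roots: "root_count \<Gamma> l g = card (roots \<Gamma> l g)"
  by (simp add: root_count_def roots_def)

text \<open>Conjugacy is phrased as an intertwining relation, so that in a symmetric group it says that a
  bijection carries one permutation to the other and no inverse has to be computed.\<close>

definition conjugate_in :: "('a, 'b) monoid_scheme \<Rightarrow> 'a \<Rightarrow> 'a \<Rightarrow> bool" where
  "conjugate_in N g h \<longleftrightarrow> (\<exists>s\<in>carrier N. h \<otimes>\<^bsub>N\<^esub> s = s \<otimes>\<^bsub>N\<^esub> g)"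

lemma pow_consistent_carrier_update:
  "x [^]\<^bsub>N\<lparr>carrier := H\<rparr>\<^esub> (k::nat) = x [^]\<^bsub>N\<^esub> k"
  by (simp add: nat_pow_def)

lemma conj_class_central:
  assumes "group G" "x \<in> carrier G" "\<And>g. g \<in> carrier G \<Longrightarrow> g \<otimes>\<^bsub>G\<^esub> x = x \<otimes>\<^bsub>G\<^esub> g"
  shows "conj_class G x = {x}"
proof -
  interpret group G by fact
  have *: "g \<otimes>\<^bsub>G\<^esub> x \<otimes>\<^bsub>G\<^esub> inv\<^bsub>G\<^esub> g = x" if "g \<in> carrier G" for g
    using that assms(2,3) by (simp add: m_assoc)
  show ?thesis
    unfolding conj_class_def using * one_closed by force
qed

text \<open>Pairing with \<open>t\<close> turns \<open>\<gamma>(t)\<close> into a comparison of two root counts: for one-element classes \<open>t\<close> is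
  the order of the group times a difference of two point masses, and the order cancels.\<close>

lemma class_inner_root_count:
  assumes "finite (carrier G)" "0 < order G" "x \<in> carrier G" "y \<in> carrier G"
  shows "class_inner G (\<lambda>h. of_real (class_diff G {x} {y} h)) (\<lambda>h. of_nat (root_count G l h))
    = of_nat (root_count G l x) - of_nat (root_count G l y)"
proof -
  have "(\<Sum>h\<in>carrier G. of_real (class_diff G {x} {y} h) * cnj (of_nat (root_count G l h)))
    = (\<Sum>h\<in>carrier G. (if h = x then of_nat (order G) * of_nat (root_count G l h) else 0)
        - (if h = y then of_nat (order G) * of_nat (root_count G l h) else (0::complex)))"
    by (intro sum.cong) (auto simp: class_diff_def indicator_def algebra_simps)
  also have "\<dots> = of_nat (order G) * (of_nat (root_count G l x) - of_nat (root_count G l y))"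
    using assms by (simp add: sum_subtractf algebra_simps)
  finally show ?thesis
    using assms(2) by (simp add: class_inner_def)
qed

text \<open>The same cancellation for \<open>\<iota>\<close>: up to the order of a centralizer, the induced function at \<open>a\<close>
  counts the \<open>l\<close>-th roots of \<open>x\<close> that are conjugate to \<open>a\<close> in the big group and subtracts the
  corresponding count for \<open>y\<close>.\<close>

lemma induced_class_diff:
  assumes "finite (carrier N)" "order G \<noteq> 0" "carrier G \<subseteq> carrier N" "finite (carrier G)"
  shows "induced G N (\<lambda>h. of_real (class_diff G {x} {y} (h [^]\<^bsub>G\<^esub> (l::nat)))) a
    = of_nat (\<Sum>h\<in>roots G l x. card {b \<in> carrier N. inv\<^bsub>N\<^esub> b \<otimes>\<^bsub>N\<^esub> a \<otimes>\<^bsub>N\<^esub> b = h})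
    - of_nat (\<Sum>h\<in>roots G l y. card {b \<in> carrier N. inv\<^bsub>N\<^esub> b \<otimes>\<^bsub>N\<^esub> a \<otimes>\<^bsub>N\<^esub> b = h})"
proof -
  define c where "c b = inv\<^bsub>N\<^esub> b \<otimes>\<^bsub>N\<^esub> a \<otimes>\<^bsub>N\<^esub> b" for b
  define B where "B = {b \<in> carrier N. c b \<in> carrier G}"
  have fB: "finite B" using assms(1) by (simp add: B_def)
  have fR: "finite (roots G l z)" for z using assms(4) by (simp add: roots_def)
  have cnt: "(\<Sum>h\<in>roots G l z. card {b \<in> carrier N. c b = h}) = card {b \<in> B. c b [^]\<^bsub>G\<^esub> l = z}" for z
  proof -
    have "(\<Sum>h\<in>roots G l z. card {b \<in> carrier N. c b = h}) = card (\<Union>h\<in>roots G l z. {b \<in> carrier N. c b = h})"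
      using assms(1) fR by (intro card_UN_disjoint[symmetric]) auto
    also have "(\<Union>h\<in>roots G l z. {b \<in> carrier N. c b = h}) = {b \<in> B. c b [^]\<^bsub>G\<^esub> l = z}"
      by (auto simp: B_def roots_def)
    finally show ?thesis .
  qed
  have "(\<Sum>b\<in>B. of_real (class_diff G {x} {y} (c b [^]\<^bsub>G\<^esub> l)))
     = (\<Sum>b\<in>B. of_nat (order G) * ((if c b [^]\<^bsub>G\<^esub> l = x then 1 else 0) - (if c b [^]\<^bsub>G\<^esub> l = y then 1 else (0::complex))))"
    by (intro sum.cong) (auto simp: class_diff_def indicator_def)
  also have "\<dots> = of_nat (order G) * (of_nat (card {b \<in> B. c b [^]\<^bsub>G\<^esub> l = x}) - of_nat (card {b \<in> B. c b [^]\<^bsub>G\<^esub> l = y}))"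
    using fB by (simp add: sum_subtractf flip: sum_distrib_left sum.inter_filter)
  finally show ?thesis
    using assms(2) unfolding induced_def c_def[symmetric] B_def[symmetric] cnt by simp
qed

text \<open>The sets are empty or cosets of one centralizer; right multiplication by a conjugating element carries one
  to the other.\<close>

lemma card_conjugators_cong:
  assumes "group N" "conjugate_in N g h" "g \<in> carrier N" "h \<in> carrier N" "a \<in> carrier N"
  shows "card {b \<in> carrier N. inv\<^bsub>N\<^esub> b \<otimes>\<^bsub>N\<^esub> a \<otimes>\<^bsub>N\<^esub> b = g} = card {b \<in> carrier N. inv\<^bsub>N\<^esub> b \<otimes>\<^bsub>N\<^esub> a \<otimes>\<^bsub>N\<^esub> b = h}"
proof -
  interpret group N by fact
  obtain s where s: "s \<in> carrier N" "h \<otimes>\<^bsub>N\<^esub> s = s \<otimes>\<^bsub>N\<^esub> g"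
    using assms(2) unfolding conjugate_in_def by blast
  have eq: "inv\<^bsub>N\<^esub> b \<otimes>\<^bsub>N\<^esub> a \<otimes>\<^bsub>N\<^esub> b = k \<longleftrightarrow> a \<otimes>\<^bsub>N\<^esub> b = b \<otimes>\<^bsub>N\<^esub> k" if "b \<in> carrier N" "k \<in> carrier N" for b k
    using that assms(5) by (metis inv_closed inv_solve_left m_assoc m_closed)
  have key: "a \<otimes>\<^bsub>N\<^esub> (b \<otimes>\<^bsub>N\<^esub> s) = (b \<otimes>\<^bsub>N\<^esub> s) \<otimes>\<^bsub>N\<^esub> g \<longleftrightarrow> a \<otimes>\<^bsub>N\<^esub> b = b \<otimes>\<^bsub>N\<^esub> h" if "b \<in> carrier N" for b
  proof -
    have "(b \<otimes>\<^bsub>N\<^esub> s) \<otimes>\<^bsub>N\<^esub> g = (b \<otimes>\<^bsub>N\<^esub> h) \<otimes>\<^bsub>N\<^esub> s"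
      using s that assms by (simp add: m_assoc)
    then show ?thesis
      using s(1) that assms by (metis m_assoc m_closed right_cancel)
  qed
  have key': "a \<otimes>\<^bsub>N\<^esub> (b \<otimes>\<^bsub>N\<^esub> inv\<^bsub>N\<^esub> s) = (b \<otimes>\<^bsub>N\<^esub> inv\<^bsub>N\<^esub> s) \<otimes>\<^bsub>N\<^esub> h \<longleftrightarrow> a \<otimes>\<^bsub>N\<^esub> b = b \<otimes>\<^bsub>N\<^esub> g" if "b \<in> carrier N" for b
    using key[of "b \<otimes>\<^bsub>N\<^esub> inv\<^bsub>N\<^esub> s"] s(1) that assms by (simp add: m_assoc)
  have set_eq: "{b \<in> carrier N. inv\<^bsub>N\<^esub> b \<otimes>\<^bsub>N\<^esub> a \<otimes>\<^bsub>N\<^esub> b = k} = {b \<in> carrier N. a \<otimes>\<^bsub>N\<^esub> b = b \<otimes>\<^bsub>N\<^esub> k}"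
    if "k \<in> carrier N" for k
    using eq that by blast
  have "bij_betw (\<lambda>b. b \<otimes>\<^bsub>N\<^esub> s) {b \<in> carrier N. a \<otimes>\<^bsub>N\<^esub> b = b \<otimes>\<^bsub>N\<^esub> h} {b \<in> carrier N. a \<otimes>\<^bsub>N\<^esub> b = b \<otimes>\<^bsub>N\<^esub> g}"
    using s(1) key key'
    by (intro bij_betw_byWitness[where f' = "\<lambda>b. b \<otimes>\<^bsub>N\<^esub> inv\<^bsub>N\<^esub> s"]) (auto simp: m_assoc[of _ s] m_assoc[of _ "inv\<^bsub>N\<^esub> s"] simp del: m_assoc)
  then have "card {b \<in> carrier N. a \<otimes>\<^bsub>N\<^esub> b = b \<otimes>\<^bsub>N\<^esub> h} = card {b \<in> carrier N. a \<otimes>\<^bsub>N\<^esub> b = b \<otimes>\<^bsub>N\<^esub> g}"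
    by (rule bij_betw_same_card)
  then show ?thesis using set_eq assms by simp
qed

lemma Inf_enat_image_eq:
  assumes "d \<in> S" "\<And>l. l \<in> S \<Longrightarrow> d \<le> l"
  shows "Inf (enat ` S) = enat d"
  using assms by (intro antisym Inf_lower imageI Inf_greatest) auto

text \<open>For central \<open>x\<close> and \<open>y\<close>, the equality \<open>\<gamma>(t) = 2\<iota>(t)\<close> becomes elementary. The root counts first
  differ at \<open>2d\<close>, hence \<open>\<gamma>(t) = 2d\<close>. For \<open>l < d\<close> a matching of the \<open>l\<close>-th roots of \<open>x\<close> with those of
  \<open>y\<close> that respects conjugacy in \<open>N\<close> makes the induced function vanish, and at \<open>d\<close> it does not vanish
  on a root of \<open>x\<close> to which no root of \<open>y\<close> is conjugate; hence \<open>\<iota>(t) = d\<close>.\<close>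

lemma property_Q_criterion:
  assumes G: "group G" "finite (carrier G)" and N: "group N" "finite (carrier N)"
    and \<phi>: "\<phi> \<in> mon G N"
    and x: "x \<in> carrier G" "\<And>g. g \<in> carrier G \<Longrightarrow> g \<otimes>\<^bsub>G\<^esub> x = x \<otimes>\<^bsub>G\<^esub> g"
    and y: "y \<in> carrier G" "\<And>g. g \<in> carrier G \<Longrightarrow> g \<otimes>\<^bsub>G\<^esub> y = y \<otimes>\<^bsub>G\<^esub> g"
    and d: "3 \<le> d" "odd d" "squarefree d"
    and ord_eq: "\<And>k::nat. x [^]\<^bsub>G\<^esub> k = \<one>\<^bsub>G\<^esub> \<longleftrightarrow> y [^]\<^bsub>G\<^esub> k = \<one>\<^bsub>G\<^esub>"
    and count_eq: "\<And>l. 0 < l \<Longrightarrow> squarefree l \<Longrightarrow> l < 2 * d \<Longrightarrow> root_count G l x = root_count G l y"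
    and count_less: "root_count G (2 * d) x < root_count G (2 * d) y"
    and match: "\<And>l. 0 < l \<Longrightarrow> squarefree l \<Longrightarrow> l < d \<Longrightarrow>
      \<exists>\<beta>. bij_betw \<beta> (roots G l x) (roots G l y) \<and>
          (\<forall>h\<in>roots G l x. conjugate_in N (\<phi> h) (\<phi> (\<beta> h)))"
    and sep: "h\<^sub>0 \<in> roots G d x" "\<And>h. h \<in> roots G d y \<Longrightarrow> \<not> conjugate_in N (\<phi> h\<^sub>0) (\<phi> h)"
  shows "property_Q (\<phi> ` carrier G) N (2 * d) (\<phi> x) (\<phi> y)"
proof -
  interpret G: group G by fact
  interpret N: group N by fact
  have hom: "\<phi> \<in> hom G N" and inj: "inj_on \<phi> (carrier G)"
    using \<phi> by (auto simp: mon_def)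
  interpret h: group_hom G N \<phi>
    by unfold_locales (fact hom)
  define H where "H = N\<lparr>carrier := \<phi> ` carrier G\<rparr>"
  have sub: "subgroup (\<phi> ` carrier G) N"
    by (rule h.img_is_subgroup)
  have H: "group H" unfolding H_def
    by (rule subgroup.subgroup_is_group[OF sub N(1)])
  have carH: "carrier H = \<phi> ` carrier G" by (simp add: H_def)
  have powH: "h [^]\<^bsub>H\<^esub> (k::nat) = h [^]\<^bsub>N\<^esub> k" for h k
    by (simp add: H_def pow_consistent_carrier_update)
  have multH: "g \<otimes>\<^bsub>H\<^esub> h = g \<otimes>\<^bsub>N\<^esub> h" and oneH: "\<one>\<^bsub>H\<^esub> = \<one>\<^bsub>N\<^esub>" for g h
    by (simp_all add: H_def)
  have finH: "finite (carrier H)" using G(2) by (simp add: carH)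
  have \<phi>in: "\<phi> g \<in> carrier N" if "g \<in> carrier G" for g
    using that by simp
  have \<phi>eq: "\<phi> g = \<phi> h \<longleftrightarrow> g = h" if "g \<in> carrier G" "h \<in> carrier G" for g h
    using that inj by (auto dest: inj_onD)
  have \<phi>pow: "\<phi> g [^]\<^bsub>N\<^esub> (k::nat) = \<phi> (g [^]\<^bsub>G\<^esub> k)" if "g \<in> carrier G" for g k
    using that by (simp add: h.hom_nat_pow)
  have rootsH: "roots H l (\<phi> z) = \<phi> ` roots G l z" if "z \<in> carrier G" for l z
    using that by (auto simp: roots_def carH powH \<phi>pow \<phi>eq)
  have rinj: "inj_on \<phi> (roots G l z)" for l z
    by (rule inj_on_subset[OF inj]) (auto simp: roots_def)
  have rc: "root_count H l (\<phi> z) = root_count G l z" if "z \<in> carrier G" for l z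
    using that rinj by (simp add: root_count_eq_card_roots rootsH card_image)
  have xy: "\<phi> x \<in> carrier H" "\<phi> y \<in> carrier H" using x y by (auto simp: carH)
  have ccx: "conj_class H (\<phi> x) = {\<phi> x}"
    using H xy x by (intro conj_class_central) (auto simp: carH multH simp flip: h.hom_mult)
  have ccy: "conj_class H (\<phi> y) = {\<phi> y}"
    using H xy y by (intro conj_class_central) (auto simp: carH multH simp flip: h.hom_mult)
  have ordH: "order H \<noteq> 0"
    using finH xy by (auto simp: order_def)
  have "group.ord H (\<phi> x) = group.ord H (\<phi> y)"
  proof -
    have "\<phi> z [^]\<^bsub>H\<^esub> (k::nat) = \<one>\<^bsub>H\<^esub> \<longleftrightarrow> z [^]\<^bsub>G\<^esub> k = \<one>\<^bsub>G\<^esub>" if "z \<in> carrier G" for z k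
      using that \<phi>eq[of "z [^]\<^bsub>G\<^esub> k" "\<one>\<^bsub>G\<^esub>"] by (simp add: powH oneH \<phi>pow)
    then show ?thesis
      using ord_eq x(1) y(1) by (simp add: group.ord_def[OF H])
  qed
  then have P: "property_P H (2 * d) (\<phi> x) (\<phi> y)"
    unfolding property_P_def
    using H finH xy d count_eq count_less x(1) y(1)
    by (auto simp: rc squarefree_mult_coprime squarefree_prime)
  let ?t = "class_diff H {\<phi> x} {\<phi> y}"
  have gam: "gamma_inv H ?t = enat (2 * d)"
  proof -
    let ?S = "{l. 0 < l \<and> squarefree l \<and> root_count G l x \<noteq> root_count G l y}"
    have "gamma_inv H ?t = Inf (enat ` ?S)"
      unfolding gamma_inv_def using class_inner_root_count[OF finH _ xy] ordH
      by (simp add: rc x(1) y(1))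
    also have "\<dots> = enat (2 * d)"
      using P count_less count_eq
      by (intro Inf_enat_image_eq) (auto simp: property_P_def simp flip: not_less)
    finally show ?thesis .
  qed
  define k where "k a h = card {b \<in> carrier N. inv\<^bsub>N\<^esub> b \<otimes>\<^bsub>N\<^esub> a \<otimes>\<^bsub>N\<^esub> b = \<phi> h}" for a h
  have ind: "induced H N (\<lambda>h. of_real (?t (h [^]\<^bsub>H\<^esub> l))) a
      = of_nat (\<Sum>h\<in>roots G l x. k a h) - of_nat (\<Sum>h\<in>roots G l y. k a h)" for l :: nat and a
    using induced_class_diff[OF N(2) ordH _ finH, of "\<phi> x" "\<phi> y" l a] sub rinj
    by (simp add: carH subgroup.subset rootsH x(1) y(1) sum.reindex k_def)
  have iot: "iota H N ?t = enat d"
  proof -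
    let ?S = "{l. 0 < l \<and> squarefree l \<and>
      (\<exists>a\<in>carrier N. induced H N (\<lambda>h. of_real (?t (h [^]\<^bsub>H\<^esub> l))) a \<noteq> 0)}"
    have zero: "induced H N (\<lambda>h. of_real (?t (h [^]\<^bsub>H\<^esub> l))) a = 0"
      if l: "0 < l" "squarefree l" "l < d" and a: "a \<in> carrier N" for l a
    proof -
      obtain \<beta> where \<beta>: "bij_betw \<beta> (roots G l x) (roots G l y)"
        and c: "\<And>h. h \<in> roots G l x \<Longrightarrow> conjugate_in N (\<phi> h) (\<phi> (\<beta> h))"
        using match[OF l] by blast
      have "k a (\<beta> h) = k a h" if h: "h \<in> roots G l x" for h
      proof -
        have "\<beta> h \<in> roots G l y" using \<beta> h by (auto simp: bij_betw_def)
        then show ?thesis using h card_conjugators_cong[OF N(1) c[OF h] _ _ a]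
          by (simp add: k_def roots_def)
      qed
      then have "(\<Sum>h\<in>roots G l y. k a h) = (\<Sum>h\<in>roots G l x. k a h)"
        using sum.reindex_bij_betw[OF \<beta>, of "k a"] by simp
      then show ?thesis by (simp add: ind)
    qed
    have "d \<in> ?S"
    proof -
      have h0: "h\<^sub>0 \<in> carrier G" using sep(1) by (simp add: roots_def)
      have "k (\<phi> h\<^sub>0) h = 0" if h: "h \<in> roots G d y" for h
      proof -
        have hc: "h \<in> carrier G" using h by (simp add: roots_def)
        have False if b: "b \<in> carrier N" "inv\<^bsub>N\<^esub> b \<otimes>\<^bsub>N\<^esub> \<phi> h\<^sub>0 \<otimes>\<^bsub>N\<^esub> b = \<phi> h" for b
        proof -
          have "\<phi> h \<otimes>\<^bsub>N\<^esub> inv\<^bsub>N\<^esub> b = inv\<^bsub>N\<^esub> b \<otimes>\<^bsub>N\<^esub> \<phi> h\<^sub>0"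
            using b h0 by (simp add: N.m_assoc flip: b(2))
          then show False using sep(2)[OF h] b by (auto simp: conjugate_in_def)
        qed
        then have "{b \<in> carrier N. inv\<^bsub>N\<^esub> b \<otimes>\<^bsub>N\<^esub> \<phi> h\<^sub>0 \<otimes>\<^bsub>N\<^esub> b = \<phi> h} = {}" by blast
        then show ?thesis by (simp only: k_def card.empty)
      qed
      then have 1: "(\<Sum>h\<in>roots G d y. k (\<phi> h\<^sub>0) h) = 0" by simp
      have "\<one>\<^bsub>N\<^esub> \<in> {b \<in> carrier N. inv\<^bsub>N\<^esub> b \<otimes>\<^bsub>N\<^esub> \<phi> h\<^sub>0 \<otimes>\<^bsub>N\<^esub> b = \<phi> h\<^sub>0}"
        using h0 by simp
      then have "0 < k (\<phi> h\<^sub>0) h\<^sub>0"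
        unfolding k_def using N(2) by (subst card_gt_0_iff) auto
      then have "(\<Sum>h\<in>roots G d x. k (\<phi> h\<^sub>0) h) \<noteq> 0"
        using sep(1) G(2) by (subst sum_eq_0_iff) (auto simp: roots_def)
      then have "induced H N (\<lambda>h. of_real (?t (h [^]\<^bsub>H\<^esub> d))) (\<phi> h\<^sub>0) \<noteq> 0"
        unfolding ind 1 by (simp del: of_nat_sum)
      then show ?thesis using d h0 by (auto intro: bexI[of _ "\<phi> h\<^sub>0"])
    qed
    moreover have "d \<le> l" if "l \<in> ?S" for l
      using that zero by (force simp: not_less[symmetric])
    ultimately show ?thesis unfolding iota_def by (rule Inf_enat_image_eq)
  qed
  have "property_P H (2 * d) (\<phi> x) (\<phi> y) \<and> gamma_inv H ?t = 2 * iota H N ?t"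
    using P by (simp add: gam iot numeral_eq_enat)
  then show ?thesis
    unfolding property_Q_def Let_def H_def[symmetric] ccx ccy
    using N sub d by auto
qed

section \<open>Translations by elements of equal order\<close>

text \<open>Choosing a representative in every right coset of \<open>\<langle>g\<rangle>\<close> gives coordinates in which left multiplication
  by \<open>g\<close> only advances a cyclic exponent.\<close>

lemma (in group) cyclic_transversal:
  assumes "finite (carrier G)" "g \<in> carrier G"
  obtains T where "T \<subseteq> carrier G" "bij_betw (\<lambda>(i, t). g [^] (i::nat) \<otimes> t) ({..<ord g} \<times> T) (carrier G)"
proof -
  define C where "C = range (\<lambda>i::nat. g [^] i)"
  have Cgen: "C = generate G {g}"
    using generate_pow_nat[OF assms(2)] assms ord_ge_1[OF assms]
    by (auto simp: C_def)
  have C: "subgroup C G" unfolding Cgen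
    by (rule generate_is_subgroup) (use assms in simp)
  interpret C: subgroup C G by fact
  define rep :: "'a set \<Rightarrow> 'a" where "rep K = (SOME t. t \<in> K)" for K
  define T where "T = rep ` (rcosets C)"
  have rep: "rep K \<in> K" if "K \<in> rcosets C" for K
    using rcos_self[OF _ C] that unfolding rep_def by (auto simp: RCOSETS_def some_in_eq)
  have Tc: "t \<in> carrier G" if "t \<in> T" for t
    using that rep C.rcosets_carrier[OF is_group] by (auto simp: T_def)
  have coset_rep: "C #> rep K = K" if "K \<in> rcosets C" for K
  proof -
    obtain w where w: "w \<in> carrier G" "K = C #> w"
      using \<open>K \<in> rcosets C\<close> unfolding RCOSETS_def by blast
    then have "rep K \<in> C #> w" using rep[OF that] by simp
    from repr_independence[OF this w(1) C] show ?thesis using w(2) by simp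
  qed
  show ?thesis
  proof (rule that[of T], use Tc in blast, rule bij_betw_imageI)
    show "inj_on (\<lambda>(i, t). g [^] (i::nat) \<otimes> t) ({..<ord g} \<times> T)"
    proof (rule inj_onI, clarsimp)
      fix i t j s
      assume i: "i < ord g" "t \<in> T" "j < ord g" "s \<in> T" and eq: "g [^] i \<otimes> t = g [^] j \<otimes> s"
      obtain K L where K: "K \<in> rcosets C" "t = rep K" and L: "L \<in> rcosets C" "s = rep L"
        using i by (auto simp: T_def)
      have "C #> t = C #> s"
      proof -
        have "C #> (g [^] k \<otimes> w) = C #> w" if "w \<in> T" for k :: nat and w
        proof -
          have "C #> (g [^] k \<otimes> w) = (C #> g [^] k) #> w"
            using Tc[OF that] assms C.subset by (simp add: coset_mult_assoc)
          also have "C #> g [^] k = C"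
            using assms C by (intro coset_join2) (auto simp: C_def)
          finally show ?thesis .
        qed
        note this[OF i(2), of i] this[OF i(4), of j]
        then show ?thesis using eq by simp
      qed
      moreover have "K = C #> t" "L = C #> s"
        using coset_rep K L by simp_all
      ultimately have "K = L" by (simp only:)
      then have ts: "t = s" unfolding K(2) L(2) by (rule arg_cong)
      then have "g [^] i = g [^] j" 
        using eq right_cancel[OF _ nat_pow_closed[OF assms(2)] nat_pow_closed[OF assms(2)]] Tc[OF i(4)] by blast
      moreover have "i \<in> {0..ord g - 1}" "j \<in> {0..ord g - 1}" using i by auto
      ultimately have "i = j" by (rule inj_onD[OF ord_inj[OF assms(2)]])
      then show "i = j \<and> t = s" using ts by simp
    qed
    show "(\<lambda>(i, t). g [^] (i::nat) \<otimes> t) ` ({..<ord g} \<times> T) = carrier G"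
    proof (intro equalityI subsetI)
      fix z assume "z \<in> (\<lambda>(i, t). g [^] (i::nat) \<otimes> t) ` ({..<ord g} \<times> T)"
      then show "z \<in> carrier G" using Tc assms by auto
    next
      fix z assume z: "z \<in> carrier G"
      let ?K = "C #> z"
      have K: "?K \<in> rcosets C" using z by (auto simp: RCOSETS_def)
      then have "z \<in> C #> rep ?K" using rcos_self[OF z C] coset_rep by simp
      then obtain i where i: "z = g [^] (i::nat) \<otimes> rep ?K"
        by (auto simp: r_coset_def C_def)
      have "g [^] i = g [^] (i mod ord g)"
      proof -
        have "g [^] (ord g * q + m) = g [^] m" for q m :: nat
          using assms(2) by (simp flip: nat_pow_mult nat_pow_pow)
        from this[of "i div ord g" "i mod ord g"] show ?thesis by simp
      qed
      then show "z \<in> (\<lambda>(i, t). g [^] (i::nat) \<otimes> t) ` ({..<ord g} \<times> T)"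
        using i K ord_ge_1[OF assms] by (auto simp: T_def intro!: image_eqI[of _ _ "(i mod ord g, rep ?K)"])
    qed
  qed
qed

lemma (in group) mult_pow_wrap:
  assumes "g \<in> carrier G" "i < ord g"
  shows "g \<otimes> g [^] i = g [^] (Suc i mod ord g)"
proof (cases "Suc i = ord g")
  case True
  then show ?thesis using nat_pow_Suc2[OF assms(1), of i] assms(1) by simp
next
  case False
  then show ?thesis using nat_pow_Suc2[OF assms(1), of i] assms(2) by simp
qed

text \<open>Left multiplication by \<open>g\<close> on the first factor of \<open>G \<times> H\<close> and by \<open>h\<close> on the second are isomorphic
  permutations as soon as the orders agree: in the coordinates \<open>(g\<^sup>i t, h\<^sup>j u)\<close> the map \<open>s\<close> exchanges the
  exponents \<open>i\<close> and \<open>j\<close>.\<close>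

lemma swap_cyclic_actions:
  assumes G: "group G" "finite (carrier G)" "g \<in> carrier G"
    and H: "group H" "finite (carrier H)" "h \<in> carrier H"
    and ord: "group.ord G g = group.ord H h"
  obtains s where "bij_betw s (carrier G \<times> carrier H) (carrier G \<times> carrier H)"
    "\<And>a b. a \<in> carrier G \<Longrightarrow> b \<in> carrier H \<Longrightarrow>
       s (g \<otimes>\<^bsub>G\<^esub> a, b) = (fst (s (a, b)), h \<otimes>\<^bsub>H\<^esub> snd (s (a, b)))"
proof -
  interpret G: group G by fact
  interpret H: group H by fact
  define k where "k = G.ord g"
  have k: "k = H.ord h" "0 < k" using ord G.ord_ge_1[OF G(2,3)] by (simp_all add: k_def)
  obtain T where TG: "T \<subseteq> carrier G" and T: "bij_betw (\<lambda>(i, t). g [^]\<^bsub>G\<^esub> (i::nat) \<otimes>\<^bsub>G\<^esub> t) ({..<k} \<times> T) (carrier G)" (is "bij_betw ?p _ _")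
    using G.cyclic_transversal[OF G(2,3)] unfolding k_def .
  obtain U where UH: "U \<subseteq> carrier H" and U: "bij_betw (\<lambda>(i, t). h [^]\<^bsub>H\<^esub> (i::nat) \<otimes>\<^bsub>H\<^esub> t) ({..<k} \<times> U) (carrier H)" (is "bij_betw ?q _ _")
    using H.cyclic_transversal[OF H(2,3)] unfolding k(1) .
  define p' where "p' = inv_into ({..<k} \<times> T) ?p"
  define q' where "q' = inv_into ({..<k} \<times> U) ?q"
  have p': "bij_betw p' (carrier G) ({..<k} \<times> T)" and q': "bij_betw q' (carrier H) ({..<k} \<times> U)"
    unfolding p'_def q'_def using T U by (auto intro: bij_betw_inv_into)
  have Tc: "t \<in> carrier G" if "t \<in> T" for t
    using that TG by blast
  have Uc: "t \<in> carrier H" if "t \<in> U" for t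
    using that UH by blast
  have sw: "bij_betw (\<lambda>((i, t), (j, u)). ((j, t), (i, u))) (({..<k} \<times> T) \<times> ({..<k} \<times> U)) (({..<k} \<times> T) \<times> ({..<k} \<times> U))"
    by (rule bij_betw_byWitness[where f' = "\<lambda>((i, t), (j, u)). ((j, t), (i, u))"]) auto
  define s where "s = map_prod ?p ?q \<circ> (\<lambda>((i, t), (j, u)). ((j, t), (i, u))) \<circ> map_prod p' q'"
  have "bij_betw s (carrier G \<times> carrier H) (carrier G \<times> carrier H)"
    unfolding s_def
    by (rule bij_betw_trans[OF bij_betw_map_prod[OF p' q'] bij_betw_trans[OF sw bij_betw_map_prod[OF T U]], unfolded o_assoc])
  moreover have "s (g \<otimes>\<^bsub>G\<^esub> a, b) = (fst (s (a, b)), h \<otimes>\<^bsub>H\<^esub> snd (s (a, b)))"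
    if ab: "a \<in> carrier G" "b \<in> carrier H" for a b
  proof -
    obtain i t where it: "p' a = (i, t)" "i < k" "t \<in> T" using bij_betwE[OF p'] ab by fastforce
    obtain j u where ju: "q' b = (j, u)" "j < k" "u \<in> U" using bij_betwE[OF q'] ab by fastforce
    have a: "a = g [^]\<^bsub>G\<^esub> i \<otimes>\<^bsub>G\<^esub> t"
      using bij_betw_inv_into_right[OF T ab(1)] it by (simp add: p'_def)
    note wrapG = G.mult_pow_wrap[OF G(3), folded k_def, OF it(2)]
      and wrapH = H.mult_pow_wrap[OF H(3), folded k(1), OF it(2)]
    have "g \<otimes>\<^bsub>G\<^esub> a = ?p (Suc i mod k, t)"
      using a G(3) Tc it by (simp flip: wrapG add: G.m_assoc)
    then have "p' (g \<otimes>\<^bsub>G\<^esub> a) = (Suc i mod k, t)"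
      using bij_betw_inv_into_left[OF T, of "(Suc i mod k, t)"] it k(2) by (simp add: p'_def)
    then show ?thesis
      using it ju H(3) Uc by (simp add: s_def H.m_assoc flip: wrapH)
  qed
  ultimately show ?thesis by (rule that)
qed

section \<open>Embedding a product of three groups into a symmetric group\<close>

text \<open>The group \<open>G\<close> will act on the first part, \<open>H\<close> on the second and \<open>K\<close> on the third. Copies of \<open>G \<times> H\<close> are used
  instead of \<open>G\<close> and \<open>H\<close> themselves so that an element of \<open>G\<close> and one of \<open>H\<close> with equal orders produce the same cycle type.\<close>

definition three_part_set :: "('a, 'x) monoid_scheme \<Rightarrow> ('b, 'y) monoid_scheme \<Rightarrow> ('c, 'z) monoid_scheme
    \<Rightarrow> (('a \<times> 'b) + ('a \<times> 'b) + 'c) set" where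
  "three_part_set G H K = (carrier G \<times> carrier H) <+> ((carrier G \<times> carrier H) <+> carrier K)"

text \<open>Extended by the identity outside the set, as \<open>permutes\<close> requires.\<close>

definition three_part_action :: "('a, 'x) monoid_scheme \<Rightarrow> ('b, 'y) monoid_scheme \<Rightarrow> ('c, 'z) monoid_scheme
    \<Rightarrow> 'a \<times> 'b \<times> 'c \<Rightarrow> ('a \<times> 'b) + ('a \<times> 'b) + 'c \<Rightarrow> ('a \<times> 'b) + ('a \<times> 'b) + 'c" where
  "three_part_action G H K v w =
     (if w \<in> three_part_set G H K
      then case v of (g, h, k) \<Rightarrow>
        map_sum (map_prod (mult G g) id) (map_sum (map_prod id (mult H h)) (mult K k)) w
      else w)"

lemma three_part_set_iff [simp]:
  "Inl ab \<in> three_part_set G H K \<longleftrightarrow> ab \<in> carrier G \<times> carrier H"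
  "Inr (Inl ab) \<in> three_part_set G H K \<longleftrightarrow> ab \<in> carrier G \<times> carrier H"
  "Inr (Inr c) \<in> three_part_set G H K \<longleftrightarrow> c \<in> carrier K"
  by (auto simp: three_part_set_def)

lemma three_part_set_cases:
  assumes "w \<in> three_part_set G H K"
  obtains a b where "w = Inl (a, b)" "a \<in> carrier G" "b \<in> carrier H"
  | a b where "w = Inr (Inl (a, b))" "a \<in> carrier G" "b \<in> carrier H"
  | c where "w = Inr (Inr c)" "c \<in> carrier K"
  using assms unfolding three_part_set_def by blast

lemma three_part_action_simps [simp]:
  "a \<in> carrier G \<Longrightarrow> b \<in> carrier H \<Longrightarrow>
    three_part_action G H K (g, h, k) (Inl (a, b)) = Inl (g \<otimes>\<^bsub>G\<^esub> a, b)"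
  "a \<in> carrier G \<Longrightarrow> b \<in> carrier H \<Longrightarrow>
    three_part_action G H K (g, h, k) (Inr (Inl (a, b))) = Inr (Inl (a, h \<otimes>\<^bsub>H\<^esub> b))"
  "c \<in> carrier K \<Longrightarrow> three_part_action G H K (g, h, k) (Inr (Inr c)) = Inr (Inr (k \<otimes>\<^bsub>K\<^esub> c))"
  "w \<notin> three_part_set G H K \<Longrightarrow> three_part_action G H K v w = w"
  by (simp_all add: three_part_action_def)

lemma three_part_action_permutes:
  assumes "group G" "group H" "group K" "v \<in> carrier (G \<times>\<times> H \<times>\<times> K)"
  shows "three_part_action G H K v permutes three_part_set G H K"
proof -
  interpret G: group G by fact
  interpret H: group H by fact
  interpret K: group K by fact
  obtain g h k where v: "v = (g, h, k)" "g \<in> carrier G" "h \<in> carrier H" "k \<in> carrier K"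
    using assms(4) by auto
  show ?thesis
  proof (rule bij_imp_permutes)
    show "bij_betw (three_part_action G H K v) (three_part_set G H K) (three_part_set G H K)"
      by (rule bij_betw_byWitness[where f' = "three_part_action G H K (inv\<^bsub>G\<^esub> g, inv\<^bsub>H\<^esub> h, inv\<^bsub>K\<^esub> k)"])
         (use v in \<open>auto elim!: three_part_set_cases simp: G.m_assoc[symmetric] H.m_assoc[symmetric] K.m_assoc[symmetric]\<close>)
  qed simp
qed

lemma three_part_action_mult:
  assumes "group G" "group H" "group K"
    and "v \<in> carrier (G \<times>\<times> H \<times>\<times> K)" "w \<in> carrier (G \<times>\<times> H \<times>\<times> K)"
  shows "three_part_action G H K (v \<otimes>\<^bsub>G \<times>\<times> H \<times>\<times> K\<^esub> w) = three_part_action G H K v \<circ> three_part_action G H K w"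
proof -
  interpret G: group G by fact
  interpret H: group H by fact
  interpret K: group K by fact
  obtain g h k g' h' k' where vw: "v = (g, h, k)" "w = (g', h', k')"
    "g \<in> carrier G" "h \<in> carrier H" "k \<in> carrier K"
    "g' \<in> carrier G" "h' \<in> carrier H" "k' \<in> carrier K"
    using assms(4,5) by auto
  show ?thesis
  proof
    fix z
    show "three_part_action G H K (v \<otimes>\<^bsub>G \<times>\<times> H \<times>\<times> K\<^esub> w) z
        = (three_part_action G H K v \<circ> three_part_action G H K w) z"
    proof (cases "z \<in> three_part_set G H K")
      case True
      then show ?thesis
        by (cases rule: three_part_set_cases) (use vw in \<open>simp_all add: G.m_assoc H.m_assoc K.m_assoc\<close>)
    qed simp
  qed
qed

lemma three_part_action_inj:
  assumes "group G" "group H" "group K"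
    and v: "v \<in> carrier (G \<times>\<times> H \<times>\<times> K)" "w \<in> carrier (G \<times>\<times> H \<times>\<times> K)"
    and eq: "three_part_action G H K v = three_part_action G H K w"
  shows "v = w"
proof -
  interpret G: group G by fact
  interpret H: group H by fact
  interpret K: group K by fact
  show ?thesis
    using v fun_cong[OF eq, of "Inl (\<one>\<^bsub>G\<^esub>, \<one>\<^bsub>H\<^esub>)"] fun_cong[OF eq, of "Inr (Inl (\<one>\<^bsub>G\<^esub>, \<one>\<^bsub>H\<^esub>))"]
      fun_cong[OF eq, of "Inr (Inr \<one>\<^bsub>K\<^esub>)"]
    by auto
qed

text \<open>The conjugating permutation exchanges the two copies of \<open>G \<times> H\<close>, applying the swap for \<open>g\<close> and \<open>h'\<close>
  on the way from the first to the second, and the inverse of the swap for \<open>g'\<close> and \<open>h\<close> on the way back.\<close>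

lemma three_part_action_conjugate:
  assumes G: "group G" "finite (carrier G)" and H: "group H" "finite (carrier H)" and K: "group K"
    and "g \<in> carrier G" "h \<in> carrier H" "g' \<in> carrier G" "h' \<in> carrier H" "k \<in> carrier K"
    and "group.ord G g = group.ord H h'" "group.ord H h = group.ord G g'"
  shows "\<exists>s. s permutes three_part_set G H K \<and>
    three_part_action G H K (g', h', k) \<circ> s = s \<circ> three_part_action G H K (g, h, k)"
proof -
  interpret G: group G by fact
  interpret H: group H by fact
  interpret K: group K by fact
  let ?S = "carrier G \<times> carrier H" and ?\<Omega> = "three_part_set G H K"
  obtain s where s: "bij_betw s ?S ?S"
    "\<And>a b. a \<in> carrier G \<Longrightarrow> b \<in> carrier H \<Longrightarrow> s (g \<otimes>\<^bsub>G\<^esub> a, b) = (fst (s (a, b)), h' \<otimes>\<^bsub>H\<^esub> snd (s (a, b)))"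
    using swap_cyclic_actions[OF G assms(6) H assms(9,11)] by blast
  obtain t where t: "bij_betw t ?S ?S"
    "\<And>a b. a \<in> carrier G \<Longrightarrow> b \<in> carrier H \<Longrightarrow> t (g' \<otimes>\<^bsub>G\<^esub> a, b) = (fst (t (a, b)), h \<otimes>\<^bsub>H\<^esub> snd (t (a, b)))"
    using swap_cyclic_actions[OF G assms(8) H assms(7) assms(12)[symmetric]] by blast
  define t' where "t' = inv_into ?S t"
  define s' where "s' = inv_into ?S s"
  have t': "bij_betw t' ?S ?S" unfolding t'_def using t(1) by (rule bij_betw_inv_into)
  have s': "bij_betw s' ?S ?S" unfolding s'_def using s(1) by (rule bij_betw_inv_into)
  have mem: "t w \<in> ?S" "t' w \<in> ?S" "s w \<in> ?S" "s' w \<in> ?S" if "w \<in> ?S" for w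
    using that bij_betwE[OF t(1)] bij_betwE[OF t'] bij_betwE[OF s(1)] bij_betwE[OF s'] by blast+
  have tt': "t (t' w) = w" "t' (t w) = w" and ss': "s (s' w) = w" "s' (s w) = w" if "w \<in> ?S" for w
    using bij_betw_inv_into_left[OF t(1) that] bij_betw_inv_into_right[OF t(1) that]
      bij_betw_inv_into_left[OF s(1) that] bij_betw_inv_into_right[OF s(1) that]
    by (simp_all only: t'_def s'_def)
  have t'eq: "t' (a, h \<otimes>\<^bsub>H\<^esub> b) = (g' \<otimes>\<^bsub>G\<^esub> fst (t' (a, b)), snd (t' (a, b)))"
    if ab: "a \<in> carrier G" "b \<in> carrier H" for a b
  proof -
    obtain a' b' where ab': "t' (a, b) = (a', b')" "a' \<in> carrier G" "b' \<in> carrier H"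
      using mem(2)[of "(a, b)"] ab by (cases "t' (a, b)") auto
    then have "t (a', b') = (a, b)" using tt'(1)[of "(a, b)"] ab by simp
    then have "t (g' \<otimes>\<^bsub>G\<^esub> a', b') = (a, h \<otimes>\<^bsub>H\<^esub> b)"
      using t(2) ab' by simp
    then show ?thesis using tt'(2)[of "(g' \<otimes>\<^bsub>G\<^esub> a', b')"] ab' assms(8) by simp
  qed
  define \<sigma> where "\<sigma> w = (if w \<in> ?\<Omega> then (case w of Inl x \<Rightarrow> Inr (Inl (s x)) | Inr (Inl x) \<Rightarrow> Inl (t' x)
    | Inr (Inr c) \<Rightarrow> Inr (Inr c)) else w)" for w
  have "\<sigma> permutes ?\<Omega>"
  proof (rule bij_imp_permutes)
    show "bij_betw \<sigma> ?\<Omega> ?\<Omega>"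
      by (rule bij_betw_byWitness[where f' = "\<lambda>w. case w of Inl x \<Rightarrow> Inr (Inl (t x))
            | Inr (Inl x) \<Rightarrow> Inl (s' x) | Inr (Inr c) \<Rightarrow> Inr (Inr c)"])
         (use mem tt' ss' in \<open>(auto simp: \<sigma>_def elim!: three_part_set_cases; metis)\<close>)+
  qed (simp add: \<sigma>_def)
  moreover have "three_part_action G H K (g', h', k) \<circ> \<sigma> = \<sigma> \<circ> three_part_action G H K (g, h, k)"
  proof
    fix w
    consider a b where "w = Inl (a, b)" "a \<in> carrier G" "b \<in> carrier H"
      | a b where "w = Inr (Inl (a, b))" "a \<in> carrier G" "b \<in> carrier H"
      | c where "w = Inr (Inr c)" "c \<in> carrier K" | "w \<notin> ?\<Omega>"
      unfolding three_part_set_def by blast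
    then show "(three_part_action G H K (g', h', k) \<circ> \<sigma>) w = (\<sigma> \<circ> three_part_action G H K (g, h, k)) w"
    proof cases
      case 1
      then show ?thesis using mem(3)[of "(a, b)"] s(2) assms(6)
        by (cases "s (a, b)") (simp add: \<sigma>_def)
    next
      case 2
      then show ?thesis using mem(2)[of "(a, b)"] t'eq assms(7)
        by (cases "t' (a, b)") (simp add: \<sigma>_def)
    next
      case 3
      then show ?thesis using assms(10) by (simp add: \<sigma>_def)
    next
      case 4
      then show ?thesis by (simp add: \<sigma>_def)
    qed
  qed
  ultimately show ?thesis by blast
qed

text \<open>Left multiplication by an element other than the identity moves every point, so each part is fixed
  either entirely or nowhere.\<close>

lemma card_fixed_points_three_part_action:
  assumes G: "group G" "finite (carrier G)" and H: "group H" "finite (carrier H)" and K: "group K" "finite (carrier K)"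
    and "g \<in> carrier G" "h \<in> carrier H" "k \<in> carrier K"
  shows "card {w \<in> three_part_set G H K. three_part_action G H K (g, h, k) w = w}
    = (of_bool (g = \<one>\<^bsub>G\<^esub>) + of_bool (h = \<one>\<^bsub>H\<^esub>)) * (order G * order H) + of_bool (k = \<one>\<^bsub>K\<^esub>) * order K"
proof -
  interpret G: group G by fact
  interpret H: group H by fact
  interpret K: group K by fact
  have "{w \<in> three_part_set G H K. three_part_action G H K (g, h, k) w = w}
     = (if g = \<one>\<^bsub>G\<^esub> then carrier G \<times> carrier H else {}) <+>
       ((if h = \<one>\<^bsub>H\<^esub> then carrier G \<times> carrier H else {}) <+> (if k = \<one>\<^bsub>K\<^esub> then carrier K else {}))"
    using assms by (auto elim!: three_part_set_cases split: if_splits)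
  then show ?thesis
    using assms by (auto simp: card_Plus order_def card_cartesian_product)
qed

lemma map_permutation_in_sym_group:
  assumes "inj_on e \<Omega>" "e ` \<Omega> \<subseteq> {1..N}" "p permutes \<Omega>"
  shows "map_permutation \<Omega> e p \<in> carrier (sym_group N)"
  using map_permutation_permutes[OF inj_on_imp_bij_betw[OF assms(1)] assms(3)] assms(2)
  by (auto simp: sym_group_carrier intro: permutes_subset)

lemma conjugate_in_sym_group_map_permutation:
  assumes "inj_on e \<Omega>" "e ` \<Omega> \<subseteq> {1..N}" "p permutes \<Omega>" "q permutes \<Omega>" "s permutes \<Omega>" "q \<circ> s = s \<circ> p"
  shows "conjugate_in (sym_group N) (map_permutation \<Omega> e p) (map_permutation \<Omega> e q)"
  unfolding conjugate_in_def
  using assms map_permutation_in_sym_group[OF assms(1,2,5)]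
  by (intro bexI[of _ "map_permutation \<Omega> e s"]) (simp_all add: sym_group_mult flip: map_permutation_compose')

lemma card_fixed_points_conjugate:
  assumes "conjugate_in (sym_group N) p q"
  shows "card {i \<in> {1..N}. p i = i} = card {i \<in> {1..N}. q i = i}"
proof -
  obtain s where s: "s permutes {1..N}" "q \<circ> s = s \<circ> p"
    using assms(1) by (auto simp: conjugate_in_def sym_group_def)
  have inj: "inj s" using s(1) by (rule permutes_inj)
  have qs: "q (s i) = s (p i)" for i using s(2) by (simp add: fun_eq_iff)
  have "bij_betw s {i \<in> {1..N}. p i = i} {i \<in> {1..N}. q i = i}"
  proof (rule bij_betw_imageI)
    show "inj_on s {i \<in> {1..N}. p i = i}" using inj by (rule inj_on_subset) simp
    show "s ` {i \<in> {1..N}. p i = i} = {i \<in> {1..N}. q i = i}"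
    proof (intro equalityI subsetI)
      fix j assume j: "j \<in> {i \<in> {1..N}. q i = i}"
      then obtain i where i: "i \<in> {1..N}" "j = s i"
        using permutes_image[OF s(1)] by (metis (no_types, lifting) imageE mem_Collect_eq)
      then have "p i = i" using j qs[of i] inj by (auto dest: injD)
      then show "j \<in> s ` {i \<in> {1..N}. p i = i}" using i by blast
    next
      fix j assume "j \<in> s ` {i \<in> {1..N}. p i = i}"
      then obtain i where i: "i \<in> {1..N}" "p i = i" "j = s i" by blast
      then show "j \<in> {i \<in> {1..N}. q i = i}" using qs[of i] permutes_in_image[OF s(1), of i] by simp
    qed
  qed
  then show ?thesis by (rule bij_betw_same_card)
qed

lemma card_fixed_points_map_permutation:
  fixes e :: "'w \<Rightarrow> nat"
  assumes "inj_on e \<Omega>" "e ` \<Omega> \<subseteq> {1..N}" "p permutes \<Omega>"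
  shows "card {i \<in> {1..N}. map_permutation \<Omega> e p i = i} = card {w \<in> \<Omega>. p w = w} + card ({1..N} - e ` \<Omega>)"
proof -
  have "{i \<in> {1..N}. map_permutation \<Omega> e p i = i} = e ` {w \<in> \<Omega>. p w = w} \<union> ({1..N} - e ` \<Omega>)"
    (is "?F = _")
  proof (intro equalityI subsetI)
    fix i assume i: "i \<in> ?F"
    show "i \<in> e ` {w \<in> \<Omega>. p w = w} \<union> ({1..N} - e ` \<Omega>)"
    proof (cases "i \<in> e ` \<Omega>")
      case True
      then obtain w where w: "w \<in> \<Omega>" "i = e w" by blast
      then have "e (p w) = e w" using i map_permutation_apply[OF assms(1) w(1)] by auto
      then have "p w = w"
        using assms(1) w(1) permutes_in_image[OF assms(3)] by (auto dest: inj_onD)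
      then show ?thesis using w by blast
    qed (use i in auto)
  next
    fix i assume "i \<in> e ` {w \<in> \<Omega>. p w = w} \<union> ({1..N} - e ` \<Omega>)"
    then show "i \<in> ?F"
    proof
      assume "i \<in> e ` {w \<in> \<Omega>. p w = w}"
      then obtain w where "w \<in> \<Omega>" "i = e w" "p w = w" by blast
      then show ?thesis using assms(2) map_permutation_apply[OF assms(1), of w p] by auto
    qed (simp add: map_permutation_def)
  qed
  moreover have "finite (e ` \<Omega>)" using finite_subset[OF assms(2)] by simp
  then have "finite \<Omega>" using assms(1) by (rule finite_imageD)
  moreover have "inj_on e {w \<in> \<Omega>. p w = w}" using assms(1) by (rule inj_on_subset) auto
  ultimately show ?thesis
    by (subst \<open>?F = _\<close>, subst card_Un_disjoint) (auto simp: card_image)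
qed


lemma conjugate_in_square:
  assumes "group N" "conjugate_in N p q" "p \<in> carrier N" "q \<in> carrier N"
  shows "conjugate_in N (p \<otimes>\<^bsub>N\<^esub> p) (q \<otimes>\<^bsub>N\<^esub> q)"
proof -
  interpret group N by fact
  obtain s where s: "s \<in> carrier N" "q \<otimes>\<^bsub>N\<^esub> s = s \<otimes>\<^bsub>N\<^esub> p"
    using assms(2) by (auto simp: conjugate_in_def)
  have "(q \<otimes>\<^bsub>N\<^esub> q) \<otimes>\<^bsub>N\<^esub> s = q \<otimes>\<^bsub>N\<^esub> (s \<otimes>\<^bsub>N\<^esub> p)"
    using s assms(3,4) by (simp add: m_assoc)
  also have "\<dots> = (q \<otimes>\<^bsub>N\<^esub> s) \<otimes>\<^bsub>N\<^esub> p"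
    using s(1) assms(3,4) by (simp add: m_assoc)
  also have "\<dots> = s \<otimes>\<^bsub>N\<^esub> (p \<otimes>\<^bsub>N\<^esub> p)"
    using s assms(3,4) by (simp add: m_assoc)
  finally show ?thesis using s(1) by (auto simp: conjugate_in_def)
qed

text \<open>The points of \<open>{1..N}\<close> outside the image of the three parts stay fixed. What is needed of the embedding
  is a sufficient and a necessary condition for conjugacy; the necessary one compares numbers of fixed
  points, and both concern elements with a common third component.\<close>

lemma sym_group_embedding:
  assumes G: "group G" "finite (carrier G)" and H: "group H" "finite (carrier H)"
    and K: "group K" "finite (carrier K)"
    and size: "2 * (order G * order H) + order K \<le> N"
  obtains \<phi> where "\<phi> \<in> mon (G \<times>\<times> H \<times>\<times> K) (sym_group N)"
    and "\<And>g h g' h' k. \<lbrakk>g \<in> carrier G; h \<in> carrier H; g' \<in> carrier G; h' \<in> carrier H; k \<in> carrier K;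
        group.ord G g = group.ord H h'; group.ord H h = group.ord G g'\<rbrakk> \<Longrightarrow>
        conjugate_in (sym_group N) (\<phi> (g, h, k)) (\<phi> (g', h', k))"
    and "\<And>g h g' h' k. \<lbrakk>g \<in> carrier G; h \<in> carrier H; g' \<in> carrier G; h' \<in> carrier H; k \<in> carrier K;
        conjugate_in (sym_group N) (\<phi> (g, h, k)) (\<phi> (g', h', k))\<rbrakk> \<Longrightarrow>
        of_bool (g = \<one>\<^bsub>G\<^esub>) + of_bool (h = \<one>\<^bsub>H\<^esub>) = (of_bool (g' = \<one>\<^bsub>G\<^esub>) + of_bool (h' = \<one>\<^bsub>H\<^esub>) :: nat)"
proof -
  let ?\<Omega> = "three_part_set G H K" and ?act = "three_part_action G H K"
  have fin: "finite ?\<Omega>" using G(2) H(2) K(2) by (simp add: three_part_set_def)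
  have "card ?\<Omega> \<le> card {1..N}"
    using size G(2) H(2) K(2) by (simp add: three_part_set_def card_Plus order_def card_cartesian_product)
  then obtain e where e: "inj_on e ?\<Omega>" "e ` ?\<Omega> \<subseteq> {1..N}"
    using card_le_inj[OF fin, of "{1..N}"] by auto
  define \<phi> where "\<phi> v = map_permutation ?\<Omega> e (?act v)" for v
  note perm = three_part_action_permutes[OF G(1) H(1) K(1)]
  have mem: "\<phi> v \<in> carrier (sym_group N)" if "v \<in> carrier (G \<times>\<times> H \<times>\<times> K)" for v
    unfolding \<phi>_def using map_permutation_in_sym_group[OF e perm[OF that]] .
  have inj: "inj_on \<phi> (carrier (G \<times>\<times> H \<times>\<times> K))"
  proof (rule inj_onI)
    fix v w assume v: "v \<in> carrier (G \<times>\<times> H \<times>\<times> K)" and w: "w \<in> carrier (G \<times>\<times> H \<times>\<times> K)"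
      and eq: "\<phi> v = \<phi> w"
    have "?act v z = ?act w z" for z
    proof (cases "z \<in> ?\<Omega>")
      case True
      then have "e (?act v z) = e (?act w z)"
        using fun_cong[OF eq, of "e z"] by (simp add: \<phi>_def map_permutation_apply[OF e(1)])
      then show ?thesis
        using e(1) True permutes_in_image[OF perm[OF v]] permutes_in_image[OF perm[OF w]]
        by (auto dest: inj_onD)
    qed simp
    then show "v = w" using three_part_action_inj[OF G(1) H(1) K(1) v w] by blast
  qed
  have "\<phi> \<in> hom (G \<times>\<times> H \<times>\<times> K) (sym_group N)"
  proof (rule homI)
    fix v w assume v: "v \<in> carrier (G \<times>\<times> H \<times>\<times> K)" and w: "w \<in> carrier (G \<times>\<times> H \<times>\<times> K)"
    show "\<phi> (v \<otimes>\<^bsub>G \<times>\<times> H \<times>\<times> K\<^esub> w) = \<phi> v \<otimes>\<^bsub>sym_group N\<^esub> \<phi> w"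
      unfolding \<phi>_def three_part_action_mult[OF G(1) H(1) K(1) v w] sym_group_mult
      by (rule map_permutation_compose'[OF e(1) perm[OF w]])
  qed (rule mem)
  then have mon: "\<phi> \<in> mon (G \<times>\<times> H \<times>\<times> K) (sym_group N)"
    using inj by (simp add: mon_def)
  show ?thesis
  proof (rule that[OF mon])
    fix g h g' h' k
    assume *: "g \<in> carrier G" "h \<in> carrier H" "g' \<in> carrier G" "h' \<in> carrier H" "k \<in> carrier K"
    {
      assume "group.ord G g = group.ord H h'" "group.ord H h = group.ord G g'"
      then show "conjugate_in (sym_group N) (\<phi> (g, h, k)) (\<phi> (g', h', k))"
        using three_part_action_conjugate[OF G H K(1) *] conjugate_in_sym_group_map_permutation[OF e perm perm] *
        unfolding \<phi>_def by auto
    }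
    assume "conjugate_in (sym_group N) (\<phi> (g, h, k)) (\<phi> (g', h', k))"
    from card_fixed_points_conjugate[OF this] have "card {w \<in> ?\<Omega>. ?act (g, h, k) w = w} = card {w \<in> ?\<Omega>. ?act (g', h', k) w = w}"
      unfolding \<phi>_def
      using card_fixed_points_map_permutation[OF e perm, of "(g, h, k)"]
        card_fixed_points_map_permutation[OF e perm, of "(g', h', k)"] * by simp
    moreover have "order G * order H > 0"
      using G H by (simp add: monoid.order_gt_0_iff_finite[OF group.is_monoid])
    ultimately show "of_bool (g = \<one>\<^bsub>G\<^esub>) + of_bool (h = \<one>\<^bsub>H\<^esub>) = (of_bool (g' = \<one>\<^bsub>G\<^esub>) + of_bool (h' = \<one>\<^bsub>H\<^esub>) :: nat)"
      using * by (simp only: card_fixed_points_three_part_action[OF G H K]) simp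
  qed
qed

section \<open>Roots in cyclic and generalized quaternion groups\<close>

lemma (in group) pow_cong_iff:
  assumes "x \<in> carrier G"
  shows "x [^] i = x [^] j \<longleftrightarrow> [i = j] (mod ord x)"
proof -
  have "x [^] i = x [^] j \<longleftrightarrow> int (ord x) dvd int j - int i"
    using int_pow_eq[OF assms, of "int i" "int j"] by (simp add: int_pow_int)
  also have "\<dots> \<longleftrightarrow> [i = j] (mod ord x)"
    by (metis cong_iff_dvd_diff cong_int_iff cong_sym_eq)
  finally show ?thesis .
qed

lemma (in group) pow_inverse_exponent:
  assumes "coprime k (order G)"
  obtains u where "\<And>x. x \<in> carrier G \<Longrightarrow> x [^] (k * u) = x"
proof -
  obtain u where u: "[k * u = 1] (mod order G)"
    using cong_solve_coprime_nat[OF assms] by auto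
  show ?thesis
  proof (rule that[of u])
    fix x assume x: "x \<in> carrier G"
    have "[k * u = 1] (mod ord x)"
      using u ord_dvd_group_order[OF x] by (rule cong_dvd_modulus_nat)
    then show "x [^] (k * u) = x"
      using pow_cong_iff[OF x, of "k * u" 1] x by simp
  qed
qed

text \<open>Raising to a power prime to the order of the group is injective, so it can be cancelled.\<close>

lemma roots_mult_coprime:
  assumes "group G" "coprime k (order G)" "e \<in> carrier G" "e [^]\<^bsub>G\<^esub> k = e"
  shows "roots G (l * k) e = roots G l e"
proof -
  interpret group G by fact
  obtain u where u: "\<And>x. x \<in> carrier G \<Longrightarrow> x [^]\<^bsub>G\<^esub> (k * u) = x"
    using pow_inverse_exponent[OF assms(2)] by blast
  have "z [^]\<^bsub>G\<^esub> (l * k) = e \<longleftrightarrow> z [^]\<^bsub>G\<^esub> l = e" if z: "z \<in> carrier G" for z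
  proof
    assume "z [^]\<^bsub>G\<^esub> (l * k) = e"
    then have "(z [^]\<^bsub>G\<^esub> (l * k)) [^]\<^bsub>G\<^esub> u = (e [^]\<^bsub>G\<^esub> k) [^]\<^bsub>G\<^esub> u"
      using assms(4) by simp
    then show "z [^]\<^bsub>G\<^esub> l = e"
      using u[of e] u[of "z [^]\<^bsub>G\<^esub> l"] z assms(3) by (simp add: nat_pow_pow mult.assoc)
  qed (use assms(3,4) z in \<open>simp flip: nat_pow_pow\<close>)
  then show ?thesis by (auto simp: roots_def)
qed

lemma pow_DirProd:
  "(g, h) [^]\<^bsub>G \<times>\<times> H\<^esub> (k::nat) = (g [^]\<^bsub>G\<^esub> k, h [^]\<^bsub>H\<^esub> k)"
  by (induction k) (simp_all add: nat_pow_def)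

lemma roots_DirProd: "roots (G \<times>\<times> H) l (x, y) = roots G l x \<times> roots H l y"
  by (auto simp: roots_def pow_DirProd)

text \<open>An \<open>l\<close>-th power with \<open>gcd(l, |K|) \<noteq> 1\<close> lies in a proper subgroup. This is the purpose of the cyclic
  factor: it removes every \<open>l\<close> that shares a factor with \<open>|K|\<close> from the comparison of roots.\<close>

lemma roots_of_generator_not_coprime:
  assumes "group K" "c \<in> carrier K" "group.ord K c = order K" "0 < order K" "\<not> coprime l (order K)"
  shows "roots K l c = {}"
proof -
  interpret group K by fact
  obtain p where p: "prime p" "p dvd l" "p dvd order K"
  proof -
    have "gcd l (order K) \<noteq> 1" using assms(5) by blast
    then show ?thesis using that prime_factor_nat by (meson gcd_greatest_iff dvd_refl)
  qed
  have False if z: "z \<in> carrier K" "z [^]\<^bsub>K\<^esub> l = c" for z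
  proof -
    obtain l' r' where lr: "l = p * l'" "order K = p * r'" using p(2,3) by (elim dvdE) blast
    have "c [^]\<^bsub>K\<^esub> r' = z [^]\<^bsub>K\<^esub> (l * r')" using nat_pow_pow[OF z(1), of l r'] z(2) by simp
    also have "l * r' = order K * l'" by (simp add: lr)
    also have "z [^]\<^bsub>K\<^esub> \<dots> = \<one>\<^bsub>K\<^esub>"
      using nat_pow_pow[OF z(1), of "order K" l'] pow_order_eq_1[OF z(1)] by simp
    finally have "c [^]\<^bsub>K\<^esub> r' = \<one>\<^bsub>K\<^esub>" .
    then have "p * r' dvd r'" using pow_eq_id[OF assms(2)] assms(3) lr(2) by simp
    moreover have "0 < r'" "r' < p * r'" using assms(4) lr(2) prime_gt_1_nat[OF p(1)] by simp_all
    ultimately show False by (auto dest: dvd_imp_le)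
  qed
  then show ?thesis by (auto simp: roots_def)
qed

lemma root_unique_coprime:
  assumes "group K" "c \<in> carrier K" "coprime l (order K)"
  shows "\<exists>z. roots K l c = {z}"
proof -
  interpret group K by fact
  obtain u where u: "\<And>x. x \<in> carrier K \<Longrightarrow> x [^]\<^bsub>K\<^esub> (l * u) = x"
    using pow_inverse_exponent[OF assms(3)] by blast
  have "z [^]\<^bsub>K\<^esub> l = c \<longleftrightarrow> z = c [^]\<^bsub>K\<^esub> u" if "z \<in> carrier K" for z
    using u[OF that] u[OF assms(2)] that assms(2) by (auto simp: nat_pow_pow mult.commute)
  then have "roots K l c = {c [^]\<^bsub>K\<^esub> u}" using assms(2) by (auto simp: roots_def)
  then show ?thesis by blast
qed

text \<open>All that the root counts use of \<open>Q\<^bsub>4n\<^esub>\<close>: a cyclic subgroup \<open>\<langle>a\<rangle>\<close> of index 2, outside of which every element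
  squares to the involution \<open>a\<^sup>n\<close> of that subgroup.\<close>

locale generalized_quaternion = group G for G (structure) +
  fixes a and n :: nat
  assumes a_carrier: "a \<in> carrier G" and n_pos: "0 < n"
    and ord_a: "ord a = 2 * n" and order_G: "order G = 4 * n"
    and square_outside: "\<And>w. w \<in> carrier G \<Longrightarrow> w \<notin> (\<lambda>i::nat. a [^] i) ` {..<2 * n} \<Longrightarrow> w \<otimes> w = a [^] n"
begin

text \<open>The element that is written \<open>-1\<close> in \<open>Q\<^bsub>4n\<^esub>\<close>.\<close>

definition m where
  "m = a [^] n"

abbreviation rotations where "rotations \<equiv> (\<lambda>i::nat. a [^] i) ` {..<2 * n}"

lemma m_carrier [simp]: "m \<in> carrier G" using a_carrier by (simp add: m_def)

lemma fin: "finite (carrier G)"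
  using order_G n_pos by (simp add: order_gt_0_iff_finite[symmetric])

lemma pow_a_eq_iff: "a [^] i = a [^] j \<longleftrightarrow> [i = j] (mod 2 * n)"
  using pow_cong_iff[OF a_carrier] by (simp add: ord_a)

lemma pow_a_eq_one_iff: "a [^] i = \<one> \<longleftrightarrow> 2 * n dvd i"
  using pow_eq_id[OF a_carrier] by (simp add: ord_a)

lemma pow_a_in_rotations: "a [^] (i::nat) \<in> rotations"
proof (rule image_eqI)
  show "a [^] i = a [^] (i mod (2 * n))" unfolding pow_a_eq_iff by (simp add: cong_def)
qed (use n_pos in simp)

lemma m_neq_one: "m \<noteq> \<one>"
  using n_pos unfolding m_def pow_a_eq_one_iff by (auto dest: dvd_imp_le)

lemma m_square: "m \<otimes> m = \<one>"
  using a_carrier by (simp add: m_def nat_pow_mult pow_a_eq_one_iff flip: mult_2)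

lemma m_pow: "m [^] (k::nat) = (if even k then \<one> else m)"
  by (induction k) (auto simp: m_square)

lemma ord_m: "ord m = 2"
  using m_neq_one by (simp add: ord_unique m_pow)

lemma card_rotations: "card rotations = 2 * n"
proof -
  have "inj_on (\<lambda>i::nat. a [^] i) {..<2 * n}"
    by (rule inj_onI) (auto simp: pow_a_eq_iff cong_def)
  then show ?thesis by (simp add: card_image)
qed

lemma rotations_subset: "rotations \<subseteq> carrier G" using a_carrier by auto

lemma square_eq_m: "w \<in> carrier G \<Longrightarrow> w \<notin> rotations \<Longrightarrow> w [^] (2::nat) = m"
  using square_outside[of w] by (simp add: m_def numeral_2_eq_2)

lemma card_outside: "card (carrier G - rotations) = 2 * n"
  using card_Diff_subset[OF _ rotations_subset] order_G by (simp add: card_rotations order_def)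

lemma m_central:
  assumes "w \<in> carrier G"
  shows "w \<otimes> m = m \<otimes> w"
proof (cases "w \<in> rotations")
  case True
  then show ?thesis using a_carrier by (auto simp: m_def nat_pow_mult add.commute)
next
  case False
  then have "m = w \<otimes> w" using square_outside assms by (simp add: m_def)
  then show ?thesis using assms by (simp add: m_assoc)
qed

lemma ord_root_m:
  assumes "z \<in> roots G 2 m"
  shows "ord z = 4"
proof -
  have z: "z \<in> carrier G" "z [^] (2::nat) = m" using assms by (auto simp: roots_def)
  have 4: "z [^] (4::nat) = \<one>" using nat_pow_pow[OF z(1), of 2 2] z(2) by (simp add: m_pow)
  then have "ord z dvd 4" using z(1) by (simp add: pow_eq_id)
  moreover have "\<not> ord z dvd 2" using z m_neq_one by (simp flip: pow_eq_id)
  moreover have "{k::nat. k dvd 4} = {1, 2, 4}"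
  proof -
    have "k \<in> {1, 2, 4}" if "k dvd 4" for k :: nat
      using dvd_imp_le[OF that] that by (cases "k = 0"; cases "k = 3") auto
    then show ?thesis by auto
  qed
  moreover from calculation have "ord z \<in> {1, 2, 4}" by blast
  ultimately show ?thesis by auto
qed

lemma involution_eq_m:
  assumes "z \<in> carrier G" "z [^] (2::nat) = \<one>" "z \<noteq> \<one>"
  shows "z = m"
proof (cases "z \<in> rotations")
  case True
  then obtain i where i: "z = a [^] i" "i < 2 * n" by auto
  then have "n dvd i" using assms(2) a_carrier by (simp add: nat_pow_pow pow_a_eq_one_iff mult.commute[of i])
  moreover have "i \<noteq> 0" using i assms(3) by (intro notI) simp
  ultimately have "i = n" using i(2) by (auto elim!: dvdE)
  then show ?thesis using i by (simp add: m_def)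
next
  case False
  then show ?thesis using square_eq_m[OF assms(1)] assms(2) m_neq_one by simp
qed

lemma roots_2_one: "roots G 2 \<one> = {\<one>, m}"
  using involution_eq_m m_square by (auto simp: roots_def numeral_2_eq_2)

lemma roots_1: "e \<in> carrier G \<Longrightarrow> roots G 1 e = {e}"
  by (auto simp: roots_def)

text \<open>The \<open>2n\<close> elements outside \<open>\<langle>a\<rangle>\<close> are square roots of \<open>-1\<close>; inside, the equation \<open>2i \<equiv> n\<close> modulo \<open>2n\<close>
  has the two solutions \<open>n/2\<close> and \<open>3n/2\<close> if \<open>n\<close> is even, and none if \<open>n\<close> is odd. Hence \<open>Q\<^bsub>4n\<^esub>\<close> and
  \<open>Q\<^bsub>4(n-1)\<^esub>\<close> have equally many for odd \<open>n\<close>.\<close>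

lemma card_roots_2_m: "card (roots G 2 m) = 2 * n + (if even n then 2 else 0)"
proof -
  have split: "roots G 2 m = (carrier G - rotations) \<union> (roots G 2 m \<inter> rotations)"
    using square_eq_m by (auto simp: roots_def)
  have iff: "a [^] i \<in> roots G 2 m \<longleftrightarrow> [2 * i = n] (mod 2 * n)" for i :: nat
    using a_carrier by (simp add: roots_def m_def nat_pow_pow pow_a_eq_iff mult.commute)
  have "card (roots G 2 m \<inter> rotations) = (if even n then 2 else 0)"
  proof (cases "even n")
    case False
    have "\<not> [2 * i = n] (mod 2 * n)" for i
    proof
      assume "[2 * i = n] (mod 2 * n)"
      then have "[2 * i = n] (mod 2)" by (rule cong_dvd_modulus_nat) simp
      then show False using False by (simp add: cong_def odd_iff_mod_2_eq_one)
    qed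
    then have "roots G 2 m \<inter> rotations = {}" using iff by auto
    then show ?thesis using False by simp
  next
    case True
    then obtain j where j: "n = 2 * j" by blast
    have "roots G 2 m \<inter> rotations = {a [^] j, a [^] (j + n)}"
    proof (intro equalityI subsetI)
      fix z assume z: "z \<in> roots G 2 m \<inter> rotations"
      then obtain i where i: "z = a [^] i" "i < 2 * n" by auto
      then have "[2 * i = n] (mod 2 * n)" using z iff[of i] by simp
      moreover have "j < n" using j n_pos by simp
      ultimately have "2 * i mod (2 * n) = 2 * j mod (2 * n)" using j by (simp add: cong_def)
      then have "2 * (i mod n) = 2 * (j mod n)" by (simp only: mult_mod_right)
      then have "i mod n = j" using \<open>j < n\<close> by simp
      moreover have "i div n < 2" using i(2) by (intro less_mult_imp_div_less) simp
      then have "i div n = 0 \<or> i div n = 1" by linarith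
      moreover have "i = q * n + j" if "i div n = q" for q
        using div_mult_mod_eq[of i n] that calculation(1) by simp
      from this[of 0] this[of 1] have "i div n = 0 \<Longrightarrow> i = j" "i div n = 1 \<Longrightarrow> i = j + n"
        by simp_all
      ultimately have "i = j \<or> i = j + n" by satx
      then show "z \<in> {a [^] j, a [^] (j + n)}" using i by auto
    next
      fix z assume "z \<in> {a [^] j, a [^] (j + n)}"
      moreover have "2 * (j + n) = n + 2 * n" using j by simp
      then have "[2 * (j + n) = n] (mod 2 * n)" by (simp only: cong_def mod_add_self2)
      moreover have "[2 * j = n] (mod 2 * n)" by (simp only: j cong_refl)
      ultimately show "z \<in> roots G 2 m \<inter> rotations"
        using pow_a_in_rotations iff by blast
    qed
    moreover have "j mod (2 * n) \<noteq> (j + n) mod (2 * n)"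
      using n_pos j by (simp add: mod_less)
    then have "a [^] j \<noteq> a [^] (j + n)"
      by (simp only: pow_a_eq_iff cong_def not_False_eq_True)
    ultimately show ?thesis using True by simp
  qed
  moreover have "card ((carrier G - rotations) \<union> (roots G 2 m \<inter> rotations))
      = card (carrier G - rotations) + card (roots G 2 m \<inter> rotations)"
    by (rule card_Un_disjoint) (use fin in auto)
  ultimately show ?thesis
    using card_outside by (subst split) (simp only:)
qed

text \<open>For odd \<open>l\<close>, multiplication by the central element \<open>-1\<close> exchanges the \<open>l\<close>-th roots of \<open>1\<close> and of \<open>-1\<close>.\<close>

lemma card_roots_odd:
  assumes "odd l"
  shows "card (roots G l m) = card (roots G l \<one>)"
proof -
  have mp: "(m \<otimes> z) [^] l = m \<otimes> z [^] l" if "z \<in> carrier G" for z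
    using pow_mult_distrib[of m z l] m_central[OF that] that assms by (simp add: m_pow)
  have mm: "m \<otimes> (m \<otimes> z) = z" if "z \<in> carrier G" for z
    using that by (simp add: m_square flip: m_assoc)
  have "bij_betw (\<lambda>z. m \<otimes> z) (roots G l m) (roots G l \<one>)"
    by (rule bij_betw_byWitness[where f' = "\<lambda>z. m \<otimes> z"]) (auto simp: roots_def mp mm m_square)
  then show ?thesis by (rule bij_betw_same_card)
qed

lemma fixed_by_odd_pow:
  assumes "odd (k::nat)" "e \<in> {\<one>, m}"
  shows "e [^] k = e"
  using assms by (auto simp: m_pow)

lemma roots_coprime:
  assumes "odd k" "coprime k n" "e \<in> {\<one>, m}"
  shows "roots G (l * k) e = roots G l e"
proof (rule roots_mult_coprime)
  have "coprime k 4" using assms(1) coprime_power_right_iff[of k 2 2] by simp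
  then show "coprime k (order G)" using assms(2) by (simp add: order_G)
qed (use assms fixed_by_odd_pow in \<open>auto simp: is_group\<close>)

text \<open>The powers of \<open>a\<close> with exponent divisible by \<open>n/d\<close> already give \<open>2d\<close> roots of \<open>1\<close>; the roots of \<open>-1\<close>
  share the remaining elements of the group.\<close>

lemma card_roots_2d:
  assumes "0 < d" "d dvd n"
  shows "2 * d \<le> card (roots G (2 * d) \<one>)"
    and "card (roots G (2 * d) m) + card (roots G (2 * d) \<one>) \<le> 4 * n"
proof -
  obtain k where k: "n = d * k" using assms(2) by blast
  have k0: "0 < k" using n_pos k by simp
  have finr: "finite (roots G l e)" for l e using fin by (simp add: roots_def)
  have "inj_on (\<lambda>i::nat. a [^] (k * i)) {..<2 * d}"
  proof (rule inj_onI)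
    fix i j assume ij: "i \<in> {..<2 * d}" "j \<in> {..<2 * d}" and eq: "a [^] (k * i) = a [^] (k * j)"
    have "k * i < 2 * n" "k * j < 2 * n" using ij k k0 by (simp_all add: mult.commute)
    then have "k * i = k * j" using eq by (simp add: pow_a_eq_iff cong_def)
    then show "i = j" using k0 by simp
  qed
  moreover have "(\<lambda>i::nat. a [^] (k * i)) ` {..<2 * d} \<subseteq> roots G (2 * d) \<one>"
    using a_carrier by (auto simp: roots_def nat_pow_pow pow_a_eq_one_iff k)
  ultimately show "2 * d \<le> card (roots G (2 * d) \<one>)"
    using card_inj_on_le[OF _ _ finr] by fastforce
  have "card (roots G (2 * d) m \<union> roots G (2 * d) \<one>) \<le> card (carrier G)"
    by (rule card_mono[OF fin]) (auto simp: roots_def)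
  moreover have "roots G (2 * d) m \<inter> roots G (2 * d) \<one> = {}"
    using m_neq_one by (auto simp: roots_def)
  ultimately show "card (roots G (2 * d) m) + card (roots G (2 * d) \<one>) \<le> 4 * n"
    using card_Un_disjoint[OF finr finr] order_G by (simp add: order_def)
qed

text \<open>The root is \<open>-a\<^sup>2\<^sup>n\<^sup>/\<^sup>d\<close>. Its square \<open>a\<^sup>4\<^sup>n\<^sup>/\<^sup>d\<close> is not \<open>1\<close> because \<open>d \<ge> 3\<close>.\<close>

lemma nontrivial_root_of_m:
  assumes "odd d" "3 \<le> d" "d dvd n"
  obtains v where "v \<in> roots G d m" "v \<otimes> v \<noteq> \<one>"
proof -
  obtain k where k: "n = d * k" using assms(3) by blast
  have k0: "0 < k" using n_pos k by simp
  let ?v = "a [^] (n + 2 * k)"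
  have "?v [^] d = m"
  proof -
    obtain j where j: "d = 2 * j + 1" using assms(1) by (auto elim: oddE)
    have "(n + 2 * k) * d = n + (j + 1) * (2 * n)"
      by (simp add: k j algebra_simps)
    then show ?thesis using a_carrier by (simp add: nat_pow_pow m_def pow_a_eq_iff cong_def)
  qed
  then have root: "?v \<in> roots G d m" using a_carrier by (simp add: roots_def)
  have "\<not> 2 * n dvd 2 * (n + 2 * k)"
  proof
    assume "2 * n dvd 2 * (n + 2 * k)"
    then have "n dvd 2 * k" by (simp add: dvd_add_right_iff)
    then have "n \<le> 2 * k" using k0 by (simp add: dvd_imp_le)
    then show False using k k0 assms(2) mult_le_mono1[OF assms(2), of k] by simp
  qed
  moreover have "?v \<otimes> ?v = a [^] (2 * (n + 2 * k))"
    by (simp only: nat_pow_mult[OF a_carrier] mult_2)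
  ultimately have "?v \<otimes> ?v \<noteq> \<one>" by (simp only: pow_a_eq_one_iff not_False_eq_True)
  with root show thesis by (rule that)
qed

end

section \<open>Products of two quaternion groups and a cyclic group\<close>

lemma (in generalized_quaternion) ord_root_of_m:
  assumes "l \<in> {1, 2}" "z \<in> roots G l m"
  shows "ord z = 2 * l"
  using assms ord_root_m ord_m roots_1 by auto

lemma (in generalized_quaternion) roots_of_one:
  assumes "l \<in> {1, 2}"
  shows "roots G l \<one> = (if l = 1 then {\<one>} else {\<one>, m})"
  using assms roots_1 roots_2_one by auto

lemma squarefree_odd_part_cases:
  assumes "0 < l" "squarefree (l::nat)"
  obtains l0 k where "l0 \<in> {1, 2}" "odd k" "squarefree k" "l = l0 * k" "0 < k"
proof (cases "even l")
  case False
  then show ?thesis using that[of 1 l] assms by simp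
next
  case True
  then obtain k where k: "l = 2 * k" by blast
  have "odd k"
  proof
    assume "even k"
    then have "2 ^ 2 dvd l" using k by (auto simp: power2_eq_square)
    then have "is_unit (2::nat)" using assms(2) unfolding squarefree_def by blast
    then show False by simp
  qed
  moreover have "squarefree k" using assms(2) k by (auto dest: squarefree_multD)
  ultimately show ?thesis using that[of 2 k] k assms(1) by simp
qed

text \<open>Let \<open>x = (-1, 1, c)\<close> and \<open>y = (1, -1, c)\<close>, and write \<open>l = l\<^sub>0k\<close> with \<open>l\<^sub>0 \<in> {1, 2}\<close> and \<open>k\<close> odd. If \<open>l\<close> shares a
  factor with \<open>|K|\<close>, there are no roots. Otherwise, as long as \<open>k < d\<close>, the exponent \<open>k\<close> is prime to the orders of
  both quaternion groups, so only \<open>l\<^sub>0\<close> matters, and the equality of the numbers of square roots of \<open>-1\<close> in the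
  two groups supplies the matching of roots. The odd \<open>l\<close> between \<open>d\<close> and \<open>2d\<close> are harmless because \<open>1\<close> and \<open>-1\<close>
  have equally many \<open>l\<close>-th roots in each group. At \<open>l = 2d\<close> the divisibility \<open>d | \<alpha>\<close> gives \<open>1\<close> so many roots in
  \<open>G\<close> that \<open>y\<close> has more roots than \<open>x\<close>; at \<open>l = d\<close> it gives a root \<open>(v, 1, z)\<close> of \<open>x\<close> with \<open>v\<^sup>2 \<noteq> 1\<close>, which numbers of
  fixed points separate from the roots \<open>(g, -1, z)\<close> of \<open>y\<close>.\<close>

lemma quaternion_product_property_Q:
  fixes d N :: nat and K :: "('k, 'z) monoid_scheme"
  assumes G: "generalized_quaternion G a \<alpha>" and H: "generalized_quaternion H b \<beta>"
    and K: "group K" "0 < order K" and c: "c \<in> carrier K" "group.ord K c = order K"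
      "\<And>z. z \<in> carrier K \<Longrightarrow> z \<otimes>\<^bsub>K\<^esub> c = c \<otimes>\<^bsub>K\<^esub> z"
    and d: "3 \<le> d" "odd d" "squarefree d"
    and d_dvd: "d dvd \<alpha>" and d_coprime: "coprime d \<beta>" "coprime d (order K)" and odd_K: "odd (order K)"
    and same: "card (roots G 2 (a [^]\<^bsub>G\<^esub> \<alpha>)) = card (roots H 2 (b [^]\<^bsub>H\<^esub> \<beta>))"
    and small: "\<And>k. odd k \<Longrightarrow> squarefree k \<Longrightarrow> k < d \<Longrightarrow> coprime k (order K) \<Longrightarrow> coprime k \<alpha> \<and> coprime k \<beta>"
    and size: "32 * (\<alpha> * \<beta>) + order K \<le> N"
  shows "\<exists>\<phi> \<in> mon (G \<times>\<times> H \<times>\<times> K) (sym_group N).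
    property_Q (\<phi> ` carrier (G \<times>\<times> H \<times>\<times> K)) (sym_group N) (2 * d)
      (\<phi> (a [^]\<^bsub>G\<^esub> \<alpha>, \<one>\<^bsub>H\<^esub>, c)) (\<phi> (\<one>\<^bsub>G\<^esub>, b [^]\<^bsub>H\<^esub> \<beta>, c))"
proof -
  interpret G: generalized_quaternion G a \<alpha> by fact
  interpret H: generalized_quaternion H b \<beta> by fact
  interpret K: group K by fact
  have finK: "finite (carrier K)" using K(2) by (simp add: K.order_gt_0_iff_finite)
  let ?P = "G \<times>\<times> H \<times>\<times> K" and ?N = "sym_group N"
  let ?x = "(G.m, \<one>\<^bsub>H\<^esub>, c)" and ?y = "(\<one>\<^bsub>G\<^esub>, H.m, c)"
  have P: "group ?P" "finite (carrier ?P)"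
    using G.fin H.fin finK by (simp_all add: DirProd_group G.is_group H.is_group K.is_group)
  have N: "group ?N" "finite (carrier ?N)"
    by (rule sym_group_is_group) (simp add: finite_permutations sym_group_def)
  have "2 * (order G * order H) + order K \<le> N"
    using size by (simp add: G.order_G H.order_G)
  then obtain \<phi> where \<phi>: "\<phi> \<in> mon ?P ?N"
    and conj: "\<And>g h g' h' k. \<lbrakk>g \<in> carrier G; h \<in> carrier H; g' \<in> carrier G; h' \<in> carrier H; k \<in> carrier K;
        G.ord g = H.ord h'; H.ord h = G.ord g'\<rbrakk> \<Longrightarrow>
        conjugate_in ?N (\<phi> (g, h, k)) (\<phi> (g', h', k))"
    and fix_eq: "\<And>g h g' h' k. \<lbrakk>g \<in> carrier G; h \<in> carrier H; g' \<in> carrier G; h' \<in> carrier H; k \<in> carrier K;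
        conjugate_in ?N (\<phi> (g, h, k)) (\<phi> (g', h', k))\<rbrakk> \<Longrightarrow>
        of_bool (g = \<one>\<^bsub>G\<^esub>) + of_bool (h = \<one>\<^bsub>H\<^esub>) = (of_bool (g' = \<one>\<^bsub>G\<^esub>) + of_bool (h' = \<one>\<^bsub>H\<^esub>) :: nat)"
    using sym_group_embedding[OF G.is_group G.fin H.is_group H.fin K(1) finK] by metis
  have roots_P: "roots ?P l (g, h, k) = roots G l g \<times> roots H l h \<times> roots K l k" for l g h k
    by (simp add: roots_DirProd)
  have count: "root_count ?P l (g, h, k) = card (roots G l g) * (card (roots H l h) * card (roots K l k))" for l g h k
    by (simp add: root_count_eq_card_roots roots_P card_cartesian_product)
  have reduce:
    "roots G (l0 * k) G.m = roots G l0 G.m" "roots G (l0 * k) \<one>\<^bsub>G\<^esub> = roots G l0 \<one>\<^bsub>G\<^esub>"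
    "roots H (l0 * k) H.m = roots H l0 H.m" "roots H (l0 * k) \<one>\<^bsub>H\<^esub> = roots H l0 \<one>\<^bsub>H\<^esub>"
    if "odd k" "squarefree k" "k < d" "coprime k (order K)" for l0 k
    using that small[OF that] by (simp_all add: G.roots_coprime H.roots_coprime)
  have same': "card (roots G l0 G.m) = card (roots H l0 H.m)" if "l0 \<in> {1, 2}" for l0
    using that same[folded G.m_def H.m_def] G.roots_1[OF G.m_carrier] H.roots_1[OF H.m_carrier] by auto
  have one': "card (roots G l0 \<one>\<^bsub>G\<^esub>) = card (roots H l0 \<one>\<^bsub>H\<^esub>)" if "l0 \<in> {1, 2}" for l0
    using that G.m_neq_one H.m_neq_one by (auto simp: G.roots_of_one H.roots_of_one)
  have no_K_roots: "roots K l c = {}" if "\<not> coprime l (order K)" for l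
    using roots_of_generator_not_coprime[OF K(1) c(1,2) K(2) that] .
  obtain v where v: "v \<in> roots G d G.m" "v \<otimes>\<^bsub>G\<^esub> v \<noteq> \<one>\<^bsub>G\<^esub>"
    using G.nontrivial_root_of_m[OF d(2,1) d_dvd] by blast
  obtain z where z: "roots K d c = {z}"
    using root_unique_coprime[OF K(1) c(1) d_coprime(2)] by blast
  have vz: "v \<in> carrier G" "z \<in> carrier K" using v z by (auto simp: roots_def)
  have Hone: "\<one>\<^bsub>H\<^esub> \<in> roots H d \<one>\<^bsub>H\<^esub>" by (simp add: roots_def)

  have "property_Q (\<phi> ` carrier ?P) ?N (2 * d) (\<phi> ?x) (\<phi> ?y)"
  proof (rule property_Q_criterion[where h\<^sub>0 = "(v, \<one>\<^bsub>H\<^esub>, z)", OF P N \<phi> _ _ _ _ d])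
    show "?x \<in> carrier ?P" "?y \<in> carrier ?P" using c by simp_all
    show "g \<otimes>\<^bsub>?P\<^esub> ?x = ?x \<otimes>\<^bsub>?P\<^esub> g" "g \<otimes>\<^bsub>?P\<^esub> ?y = ?y \<otimes>\<^bsub>?P\<^esub> g" if "g \<in> carrier ?P" for g
      using that c(3) G.m_central H.m_central by auto
    show "?x [^]\<^bsub>?P\<^esub> k = \<one>\<^bsub>?P\<^esub> \<longleftrightarrow> ?y [^]\<^bsub>?P\<^esub> k = \<one>\<^bsub>?P\<^esub>" for k :: nat
      using G.m_neq_one H.m_neq_one by (simp add: pow_DirProd G.m_pow H.m_pow)
    show "root_count ?P l ?x = root_count ?P l ?y" if l: "0 < l" "squarefree l" "l < 2 * d" for l
    proof (cases "coprime l (order K)")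
      case False
      then show ?thesis by (simp add: count no_K_roots)
    next
      case True
      obtain l0 k where lk: "l0 \<in> {1, 2}" "odd k" "squarefree k" "l = l0 * k" "0 < k"
        using squarefree_odd_part_cases[OF l(1,2)] by blast
      show ?thesis
      proof (cases "l0 = 1")
        case True
        then show ?thesis using lk G.card_roots_odd H.card_roots_odd by (simp add: count)
      next
        case False
        then have "l0 = 2" "k < d" "coprime k (order K)" using lk l(3) True by auto
        then show ?thesis using lk same' one' by (simp add: count reduce)
      qed
    qed
    show "root_count ?P (2 * d) ?x < root_count ?P (2 * d) ?y"
    proof -
      have "coprime 2 (order K)" using odd_K by simp
      then have "coprime (2 * d) (order K)" using d_coprime by simp
      then have k1: "card (roots K (2 * d) c) = 1"
        using root_unique_coprime[OF K(1) c(1)] by fastforce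
      have h1: "card (roots H (2 * d) \<one>\<^bsub>H\<^esub>) = 2"
        using H.roots_coprime[OF d(2) d_coprime(1), of "\<one>\<^bsub>H\<^esub>" 2] H.m_neq_one by (simp add: H.roots_2_one)
      have h2: "2 * \<alpha> \<le> card (roots H (2 * d) H.m)"
        using H.roots_coprime[OF d(2) d_coprime(1), of "H.m" 2] same' G.card_roots_2_m by simp
      have r: "2 * d \<le> card (roots G (2 * d) \<one>\<^bsub>G\<^esub>)"
        "card (roots G (2 * d) G.m) + card (roots G (2 * d) \<one>\<^bsub>G\<^esub>) \<le> 4 * \<alpha>"
        using G.card_roots_2d[OF _ d_dvd] d(1) by simp_all
      \<comment> \<open>The root counts of \<open>x\<close> and \<open>y\<close> are \<open>2M\<close> and \<open>Rs\<close> with \<open>M + R \<le> 4\<alpha>\<close>, \<open>R \<ge> 6\<close> and \<open>s \<ge> 2\<alpha>\<close>, so \<open>2M < 8\<alpha> < Rs\<close>.\<close>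
      have "6 * (2 * \<alpha>) \<le> card (roots G (2 * d) \<one>\<^bsub>G\<^esub>) * card (roots H (2 * d) H.m)"
        using r(1) d(1) h2 by (intro mult_le_mono) simp_all
      then show ?thesis using r(2) G.n_pos by (simp add: count k1 h1)
    qed
    show "\<exists>\<beta>. bij_betw \<beta> (roots ?P l ?x) (roots ?P l ?y) \<and>
          (\<forall>h\<in>roots ?P l ?x. conjugate_in ?N (\<phi> h) (\<phi> (\<beta> h)))"
      if l: "0 < l" "squarefree l" "l < d" for l
    proof (cases "coprime l (order K)")
      case False
      then show ?thesis by (simp add: roots_P no_K_roots bij_betw_def)
    next
      case True
      obtain l0 k where lk: "l0 \<in> {1, 2}" "odd k" "squarefree k" "l = l0 * k" "0 < k"
        using squarefree_odd_part_cases[OF l(1,2)] by blast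
      have "k < d" "coprime k (order K)" using lk l(3) True by auto
      note red = reduce[OF lk(2,3) this, of l0, folded lk(4)]
      have x: "roots ?P l ?x = roots G l0 G.m \<times> roots H l0 \<one>\<^bsub>H\<^esub> \<times> roots K l c"
        and y: "roots ?P l ?y = roots G l0 \<one>\<^bsub>G\<^esub> \<times> roots H l0 H.m \<times> roots K l c"
        by (simp_all add: roots_P red)
      have "finite (roots G l0 G.m)" "finite (roots H l0 H.m)"
        using G.fin H.fin by (simp_all add: roots_def)
      then obtain \<gamma> where \<gamma>: "bij_betw \<gamma> (roots G l0 G.m) (roots H l0 H.m)"
        using same'[OF lk(1)] by (metis finite_same_card_bij)
      define \<delta> where "\<delta> h = (if h = \<one>\<^bsub>H\<^esub> then \<one>\<^bsub>G\<^esub> else G.m)" for h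
      have \<delta>: "bij_betw \<delta> (roots H l0 \<one>\<^bsub>H\<^esub>) (roots G l0 \<one>\<^bsub>G\<^esub>)"
        unfolding H.roots_of_one[OF lk(1)] G.roots_of_one[OF lk(1)]
        using G.m_neq_one H.m_neq_one by (auto simp: bij_betw_def \<delta>_def)
      have \<delta>_ord: "H.ord h = G.ord (\<delta> h)" if "h \<in> roots H l0 \<one>\<^bsub>H\<^esub>" for h
        using that G.ord_m H.ord_m unfolding H.roots_of_one[OF lk(1)]
        by (auto simp: \<delta>_def split: if_splits)
      \<comment> \<open>The components are exchanged: \<open>\<gamma>\<close> matches elements of order \<open>2l\<^sub>0\<close>, and \<open>\<delta>\<close> matches \<open>\<plusminus>1\<close> with \<open>\<plusminus>1\<close>.\<close>
      define \<beta>' where "\<beta>' = (\<lambda>(g, h, z). (\<delta> h, \<gamma> g, z :: 'k))"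
      have bij: "bij_betw \<beta>' (roots ?P l ?x) (roots ?P l ?y)"
        unfolding x y
      proof (rule bij_betw_imageI)
        show "inj_on \<beta>' (roots G l0 G.m \<times> roots H l0 \<one>\<^bsub>H\<^esub> \<times> roots K l c)"
          using \<gamma> \<delta> by (auto simp: inj_on_def \<beta>'_def bij_betw_def)
        show "\<beta>' ` (roots G l0 G.m \<times> roots H l0 \<one>\<^bsub>H\<^esub> \<times> roots K l c) = roots G l0 \<one>\<^bsub>G\<^esub> \<times> roots H l0 H.m \<times> roots K l c"
          unfolding bij_betw_imp_surj_on[OF \<gamma>, symmetric] bij_betw_imp_surj_on[OF \<delta>, symmetric]
          by (force simp: \<beta>'_def)
      qed
      have "conjugate_in ?N (\<phi> v) (\<phi> (\<beta>' v))" if v: "v \<in> roots ?P l ?x" for v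
      proof -
        obtain g h z where v': "v = (g, h, z)" "g \<in> roots G l0 G.m" "h \<in> roots H l0 \<one>\<^bsub>H\<^esub>" "z \<in> roots K l c"
          using v unfolding x by auto
        have "\<gamma> g \<in> roots H l0 H.m" "\<delta> h \<in> roots G l0 \<one>\<^bsub>G\<^esub>"
          using bij_betwE[OF \<gamma>] bij_betwE[OF \<delta>] v' by blast+
        moreover from this have "G.ord g = H.ord (\<gamma> g)"
          using v' G.ord_root_of_m[OF lk(1)] H.ord_root_of_m[OF lk(1)] by simp
        ultimately show ?thesis
          using v' \<delta>_ord by (auto simp: \<beta>'_def roots_def intro!: conj)
      qed
      then show ?thesis using bij by blast
    qed
    show "(v, \<one>\<^bsub>H\<^esub>, z) \<in> roots ?P d ?x"
      using v z Hone by (simp add: roots_P)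
    show "\<not> conjugate_in ?N (\<phi> (v, \<one>\<^bsub>H\<^esub>, z)) (\<phi> w)" if w: "w \<in> roots ?P d ?y" for w
    proof
      assume cj: "conjugate_in ?N (\<phi> (v, \<one>\<^bsub>H\<^esub>, z)) (\<phi> w)"
      have "roots H d H.m = {H.m}"
        using H.roots_coprime[OF d(2) d_coprime(1), of "H.m" 1] H.roots_1 by simp
      then have "w \<in> roots G d \<one>\<^bsub>G\<^esub> \<times> {H.m} \<times> {z}" using w by (simp only: roots_P z)
      then obtain g where g: "w = (g, H.m, z)" "g \<in> carrier G"
        by (auto simp: roots_def)
      \<comment> \<open>The element \<open>(v, 1, z)\<close> fixes exactly one copy of \<open>G \<times> H\<close>, which forces \<open>g = 1\<close>; then the square of \<open>w\<close> fixes
          both copies, while the square of \<open>(v, 1, z)\<close> still fixes only one.\<close>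
      have "v \<noteq> \<one>\<^bsub>G\<^esub>" using v(2) by auto
      then have "g = \<one>\<^bsub>G\<^esub>"
        using fix_eq[OF vz(1) _ g(2) _ vz(2), of "\<one>\<^bsub>H\<^esub>" "H.m"] cj H.m_neq_one
        by (simp add: g(1) of_bool_def split: if_splits)
      then have w1: "w = (\<one>\<^bsub>G\<^esub>, H.m, z)" using g by simp
      have hom: "\<phi> \<in> hom ?P ?N" using \<phi> by (simp add: mon_def)
      have sq: "\<phi> s \<otimes>\<^bsub>?N\<^esub> \<phi> s = \<phi> (s \<otimes>\<^bsub>?P\<^esub> s)" "\<phi> s \<in> carrier ?N" if "s \<in> carrier ?P" for s
        using hom that by (auto simp: hom_def)
      have "conjugate_in ?N (\<phi> (v \<otimes>\<^bsub>G\<^esub> v, \<one>\<^bsub>H\<^esub>, z \<otimes>\<^bsub>K\<^esub> z)) (\<phi> (\<one>\<^bsub>G\<^esub>, \<one>\<^bsub>H\<^esub>, z \<otimes>\<^bsub>K\<^esub> z))"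
        using conjugate_in_square[OF N(1) cj[unfolded w1]] sq[of "(v, \<one>\<^bsub>H\<^esub>, z)"] sq[of "(\<one>\<^bsub>G\<^esub>, H.m, z)"] vz
        by (simp add: H.m_square)
      then have "of_bool (v \<otimes>\<^bsub>G\<^esub> v = \<one>\<^bsub>G\<^esub>) + of_bool (\<one>\<^bsub>H\<^esub> = \<one>\<^bsub>H\<^esub>) =
          (of_bool (\<one>\<^bsub>G\<^esub> = \<one>\<^bsub>G\<^esub>) + of_bool (\<one>\<^bsub>H\<^esub> = \<one>\<^bsub>H\<^esub>) :: nat)"
        by (intro fix_eq) (use vz in auto)
      then show False using v(2) by simp
    qed
  qed
  then show ?thesis using \<phi> unfolding G.m_def H.m_def by blast
qed

section \<open>Roots of unity and the presented quaternion groups\<close>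

lemma cyc_gen_eq_cis: "cyc_gen n = cis (2 * pi / real n)"
  by (simp add: cyc_gen_def cis_conv_exp mult_ac)

lemma cyc_gen_pow: "cyc_gen n ^ i = cis (2 * pi * real i / real n)"
  by (simp add: cyc_gen_eq_cis DeMoivre mult_ac)

lemma cyc_gen_pow_eq_1_iff:
  assumes "0 < n"
  shows "cyc_gen n ^ i = 1 \<longleftrightarrow> n dvd i"
proof -
  have n1: "cyc_gen n ^ n = 1" using assms by (simp add: cyc_gen_pow)
  have "cyc_gen n ^ (n * (i div n) + i mod n) = cyc_gen n ^ (i mod n)"
    unfolding power_add power_mult n1 by simp
  then have "cyc_gen n ^ i = cyc_gen n ^ (i mod n)" by simp
  also have "\<dots> = 1 \<longleftrightarrow> i mod n = 0"
    using inj_onD[OF bij_betw_imp_inj_on[OF bij_betw_roots_unity[OF assms]], of "i mod n" 0] assms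
    by (auto simp: cyc_gen_pow)
  finally show ?thesis by (simp add: dvd_eq_mod_eq_0)
qed

lemma cyc_simps [simp]:
  "carrier (cyc n) = {z. z ^ n = 1}" "mult (cyc n) = (*)" "one (cyc n) = 1"
  by (simp_all add: cyc_def)

lemma group_cyc: "0 < n \<Longrightarrow> group (cyc n)"
  by (rule groupI) (auto simp: power_mult_distrib power_inverse power_0_left intro!: exI[of _ "inverse _"] left_inverse)

lemma order_cyc: "0 < n \<Longrightarrow> order (cyc n) = n"
  by (simp add: order_def card_roots_unity_eq)

lemma pow_cyc: "z [^]\<^bsub>cyc n\<^esub> (k::nat) = z ^ k"
  by (induction k) (simp_all add: nat_pow_def mult.commute)

lemma ord_cyc_gen: "0 < n \<Longrightarrow> group.ord (cyc n) (cyc_gen n) = n"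
  using cyc_gen_pow_eq_1_iff[of n n]
  by (simp add: group.ord_unique[OF group_cyc] pow_cyc cyc_gen_pow_eq_1_iff)

lemma (in group) twisted_commute_pow:
  fixes i k :: nat
  assumes "a \<in> carrier G" "u \<in> carrier G" "u \<otimes> a = a [^] k \<otimes> u"
  shows "u \<otimes> a [^] i = a [^] (k * i) \<otimes> u"
proof (induction i)
  case (Suc i)
  have "u \<otimes> a [^] Suc i = (u \<otimes> a [^] i) \<otimes> a"
    using assms by (simp add: m_assoc)
  also have "\<dots> = a [^] (k * i) \<otimes> (u \<otimes> a)"
    using assms(1,2) by (simp add: Suc m_assoc)
  also have "\<dots> = (a [^] (k * i) \<otimes> a [^] k) \<otimes> u"
    using assms by (simp add: m_assoc)
  finally show ?case using assms(1) by (simp add: nat_pow_mult add.commute)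
qed (use assms in simp)

text \<open>The relations give the squares of the elements \<open>a\<^sup>i\<close> and \<open>a\<^sup>iu\<close>, but they cannot show that \<open>4n\<close> of these are
  distinct; the assumptions on the powers of \<open>a\<close> supply that.\<close>

lemma generalized_quaternionI:
  assumes "group G" and au: "a \<in> carrier G" "u \<in> carrier G" and n: "0 < n"
    and rel: "a [^]\<^bsub>G\<^esub> n = u \<otimes>\<^bsub>G\<^esub> u" "u \<otimes>\<^bsub>G\<^esub> a = a [^]\<^bsub>G\<^esub> (2 * n - 1) \<otimes>\<^bsub>G\<^esub> u"
    and ord_a: "\<And>i::nat. a [^]\<^bsub>G\<^esub> i = \<one>\<^bsub>G\<^esub> \<longleftrightarrow> 2 * n dvd i"
    and u: "\<And>i::nat. u \<noteq> a [^]\<^bsub>G\<^esub> i"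
    and gen: "\<And>w. w \<in> carrier G \<Longrightarrow> (\<exists>i::nat. w = a [^]\<^bsub>G\<^esub> i \<or> w = a [^]\<^bsub>G\<^esub> i \<otimes>\<^bsub>G\<^esub> u)"
  shows "generalized_quaternion G a n"
proof -
  interpret group G by fact
  have ord: "ord a = 2 * n" using au ord_a by (simp add: ord_unique)
  have eq_iff: "a [^]\<^bsub>G\<^esub> i = a [^]\<^bsub>G\<^esub> j \<longleftrightarrow> [i = j] (mod 2 * n)" for i j :: nat
    using pow_cong_iff[OF au(1)] by (simp add: ord)
  define C where "C = (\<lambda>i::nat. a [^]\<^bsub>G\<^esub> i) ` {..<2 * n}"
  have in_C: "a [^]\<^bsub>G\<^esub> i \<in> C" for i :: nat
  proof -
    have "a [^]\<^bsub>G\<^esub> i = a [^]\<^bsub>G\<^esub> (i mod (2 * n))" unfolding eq_iff by (simp add: cong_def)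
    then show ?thesis using n by (auto simp: C_def)
  qed
  note u_pow = twisted_commute_pow[OF au rel(2)]
  have carrier: "carrier G = C \<union> (\<lambda>c. c \<otimes>\<^bsub>G\<^esub> u) ` C"
  proof
    show "carrier G \<subseteq> C \<union> (\<lambda>c. c \<otimes>\<^bsub>G\<^esub> u) ` C" using gen in_C by blast
    show "C \<union> (\<lambda>c. c \<otimes>\<^bsub>G\<^esub> u) ` C \<subseteq> carrier G" using au by (auto simp: C_def)
  qed
  have disj: "C \<inter> (\<lambda>c. c \<otimes>\<^bsub>G\<^esub> u) ` C = {}"
  proof -
    have False if eq: "a [^]\<^bsub>G\<^esub> i = a [^]\<^bsub>G\<^esub> j \<otimes>\<^bsub>G\<^esub> u" for i j :: nat
    proof -
      have "[(2 * n - 1) * j + j = 0] (mod 2 * n)"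
      proof -
        have "(2 * n - 1) * j + j = 2 * n * j" using n by (cases n) (simp_all add: algebra_simps)
        then show ?thesis by (simp add: cong_def)
      qed
      then have inv: "a [^]\<^bsub>G\<^esub> ((2 * n - 1) * j) \<otimes>\<^bsub>G\<^esub> a [^]\<^bsub>G\<^esub> j = \<one>\<^bsub>G\<^esub>"
        using au eq_iff[of "(2 * n - 1) * j + j" 0] by (simp add: nat_pow_mult)
      have "a [^]\<^bsub>G\<^esub> ((2 * n - 1) * j + i) = (a [^]\<^bsub>G\<^esub> ((2 * n - 1) * j) \<otimes>\<^bsub>G\<^esub> a [^]\<^bsub>G\<^esub> j) \<otimes>\<^bsub>G\<^esub> u"
        using au by (simp add: m_assoc flip: eq nat_pow_mult)
      then have "u = a [^]\<^bsub>G\<^esub> ((2 * n - 1) * j + i)" using inv au by simp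
      then show False using u by blast
    qed
    then show ?thesis by (auto simp: C_def)
  qed
  have inj: "inj_on (\<lambda>i::nat. a [^]\<^bsub>G\<^esub> i) {..<2 * n}"
    by (rule inj_onI) (auto simp: eq_iff cong_def)
  then have card_C: "card C = 2 * n" by (simp add: C_def card_image)
  have "inj_on (\<lambda>c. c \<otimes>\<^bsub>G\<^esub> u) C"
    using au by (intro inj_onI) (auto simp: C_def)
  then have "card (carrier G) = 4 * n"
    unfolding carrier using disj card_C by (subst card_Un_disjoint) (auto simp: C_def card_image)
  moreover have "w \<otimes>\<^bsub>G\<^esub> w = a [^]\<^bsub>G\<^esub> n" if w: "w \<in> carrier G" "w \<notin> C" for w
  proof -
    obtain i :: nat where i: "w = a [^]\<^bsub>G\<^esub> i \<otimes>\<^bsub>G\<^esub> u" using gen[OF w(1)] w(2) in_C by blast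
    have "w \<otimes>\<^bsub>G\<^esub> w = a [^]\<^bsub>G\<^esub> i \<otimes>\<^bsub>G\<^esub> (u \<otimes>\<^bsub>G\<^esub> a [^]\<^bsub>G\<^esub> i) \<otimes>\<^bsub>G\<^esub> u"
      using au by (simp add: i m_assoc)
    also have "\<dots> = a [^]\<^bsub>G\<^esub> (i + (2 * n - 1) * i) \<otimes>\<^bsub>G\<^esub> (u \<otimes>\<^bsub>G\<^esub> u)"
      using au by (simp add: u_pow m_assoc flip: nat_pow_mult)
    also have "\<dots> = a [^]\<^bsub>G\<^esub> (i + (2 * n - 1) * i + n)"
      using au by (simp only: rel(1)[symmetric] nat_pow_mult)
    also have "i + (2 * n - 1) * i + n = 2 * n * i + n" using n by (cases n) (simp_all add: algebra_simps)
    also have "a [^]\<^bsub>G\<^esub> \<dots> = a [^]\<^bsub>G\<^esub> n" unfolding eq_iff by (simp add: cong_def)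
    finally show ?thesis .
  qed
  ultimately show ?thesis
    using au n ord by unfold_locales (auto simp: order_def C_def)
qed

text \<open>The two-dimensional representation \<open>a \<mapsto> diag(\<zeta>, \<zeta>\<^sup>-\<^sup>1)\<close>, \<open>u \<mapsto> (0, -1; 1, 0)\<close>. It certifies that the presented
  group does not collapse: words that are equal in the group act equally.\<close>

fun letter_action :: "complex \<Rightarrow> quat_gen \<times> bool \<Rightarrow> complex \<times> complex \<Rightarrow> complex \<times> complex" where
  "letter_action \<zeta> (A, True) (z, w) = (\<zeta> * z, inverse \<zeta> * w)"
| "letter_action \<zeta> (A, False) (z, w) = (inverse \<zeta> * z, \<zeta> * w)"
| "letter_action \<zeta> (U, True) (z, w) = (- w, z)"
| "letter_action \<zeta> (U, False) (z, w) = (w, - z)"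

definition quat_relations :: "nat \<Rightarrow> (quat_gen word \<times> quat_gen word) set" where
  "quat_relations n = {(replicate (2 * n) (A, True), []),
     (replicate n (A, True), replicate 2 (U, True)),
     ([(U, True), (A, True), (U, False)], [(A, False)])}"

lemma gen_quat_eq: "gen_quat n = presented_group (quat_relations n)"
  by (simp add: gen_quat_def quat_relations_def)

lemma foldr_letter_action_replicate:
  "foldr (letter_action \<zeta>) (replicate k (A, True)) (z, w) = (\<zeta> ^ k * z, inverse \<zeta> ^ k * w)"
  by (induction k) (simp_all add: mult_ac)

lemma word_eq_imp_same_action:
  assumes "word_eq (quat_relations n) v w" "\<zeta> ^ n = -1" "\<zeta> \<noteq> 0"
  shows "foldr (letter_action \<zeta>) v s = foldr (letter_action \<zeta>) w s"
  using assms(1)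
proof (induction arbitrary: s)
  case (rel v w)
  obtain x y where s: "s = (x, y)" by (cases s)
  have "\<zeta> ^ (2 * n) = 1" using assms(2) by (simp add: mult.commute[of 2] power_mult)
  then show ?case using rel assms(2,3)
    by (auto simp: quat_relations_def s foldr_letter_action_replicate power_inverse numeral_2_eq_2 simp del: foldr_replicate)
next
  case (cancel g e)
  obtain x y where s: "s = (x, y)" by (cases s)
  show ?case using assms(3) by (cases g; cases e) (simp_all add: s)
qed simp_all

lemma generalized_quaternion_gen_quat:
  assumes "0 < n"
  shows "generalized_quaternion (gen_quat n) (word_class (quat_relations n) [(A, True)]) n"
proof -
  let ?R = "quat_relations n" and ?Q = "gen_quat n"
  let ?c = "word_class ?R"
  let ?a = "?c [(A, True)]" and ?u = "?c [(U, True)]"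
  interpret group ?Q unfolding gen_quat_eq by (rule group_presented_group)
  have carrier: "carrier ?Q = range ?c" and one: "\<one>\<^bsub>?Q\<^esub> = ?c []"
    by (simp_all add: gen_quat_eq presented_group_def)
  have mult: "?c v \<otimes>\<^bsub>?Q\<^esub> ?c w = ?c (v @ w)" for v w
    by (simp add: gen_quat_eq presented_group_mult)
  have a: "?a \<in> carrier ?Q" and u: "?u \<in> carrier ?Q" by (simp_all add: carrier)
  have a_pow: "?a [^]\<^bsub>?Q\<^esub> i = ?c (replicate i (A, True))" for i :: nat
    by (induction i) (simp_all add: one mult replicate_append_same)
  have eqI: "?c v = ?c w" if "(v, w) \<in> ?R" for v w
    using that by (simp add: word_class_eq_iff word_eq.rel)
  have inverse_letter: "?c [(g, False)] = inv\<^bsub>?Q\<^esub> ?c [(g, True)]" for g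
  proof (rule inv_equality[symmetric])
    show "?c [(g, False)] \<otimes>\<^bsub>?Q\<^esub> ?c [(g, True)] = \<one>\<^bsub>?Q\<^esub>"
      using word_eq.cancel[of ?R g False] by (simp add: mult one word_class_eq_iff)
  qed (simp_all add: carrier)
  have rel1: "?a [^]\<^bsub>?Q\<^esub> (2 * n) = \<one>\<^bsub>?Q\<^esub>"
    unfolding a_pow one by (rule eqI) (simp add: quat_relations_def)
  have rel2: "?a [^]\<^bsub>?Q\<^esub> n = ?u \<otimes>\<^bsub>?Q\<^esub> ?u"
    unfolding a_pow mult by (rule eqI) (simp add: quat_relations_def numeral_2_eq_2)
  have a_inv: "inv\<^bsub>?Q\<^esub> ?a = ?a [^]\<^bsub>?Q\<^esub> (2 * n - 1)"
  proof (rule inv_equality)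
    have "?a [^]\<^bsub>?Q\<^esub> (2 * n - 1) \<otimes>\<^bsub>?Q\<^esub> ?a = ?a [^]\<^bsub>?Q\<^esub> Suc (2 * n - 1)" by simp
    then show "?a [^]\<^bsub>?Q\<^esub> (2 * n - 1) \<otimes>\<^bsub>?Q\<^esub> ?a = \<one>\<^bsub>?Q\<^esub>" using rel1 assms by simp
  qed (use a in simp_all)
  have "?u \<otimes>\<^bsub>?Q\<^esub> ?a \<otimes>\<^bsub>?Q\<^esub> inv\<^bsub>?Q\<^esub> ?u = inv\<^bsub>?Q\<^esub> ?a"
    unfolding inverse_letter[symmetric] mult by (simp, rule eqI) (simp add: quat_relations_def)
  then have "?u \<otimes>\<^bsub>?Q\<^esub> ?a = inv\<^bsub>?Q\<^esub> ?a \<otimes>\<^bsub>?Q\<^esub> ?u"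
    using a u by (metis inv_closed inv_solve_right m_closed)
  then have rel3: "?u \<otimes>\<^bsub>?Q\<^esub> ?a = ?a [^]\<^bsub>?Q\<^esub> (2 * n - 1) \<otimes>\<^bsub>?Q\<^esub> ?u" by (simp only: a_inv)
  note u_pow = twisted_commute_pow[OF a u rel3]
  define S where "S = {w. \<exists>i::nat. w = ?a [^]\<^bsub>?Q\<^esub> i \<or> w = ?a [^]\<^bsub>?Q\<^esub> i \<otimes>\<^bsub>?Q\<^esub> ?u}"
  have S_pow: "?a [^]\<^bsub>?Q\<^esub> (k::nat) \<otimes>\<^bsub>?Q\<^esub> w \<in> S" if "w \<in> S" for k w
    using that a u by (auto simp: S_def nat_pow_mult simp flip: m_assoc)
  have S_u: "?u \<otimes>\<^bsub>?Q\<^esub> w \<in> S" if w: "w \<in> S" for w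
  proof -
    obtain i :: nat where "w = ?a [^]\<^bsub>?Q\<^esub> i \<or> w = ?a [^]\<^bsub>?Q\<^esub> i \<otimes>\<^bsub>?Q\<^esub> ?u" using w by (auto simp: S_def)
    then have "?u \<otimes>\<^bsub>?Q\<^esub> w = ?a [^]\<^bsub>?Q\<^esub> ((2 * n - 1) * i) \<otimes>\<^bsub>?Q\<^esub> ?u \<or>
        ?u \<otimes>\<^bsub>?Q\<^esub> w = ?a [^]\<^bsub>?Q\<^esub> ((2 * n - 1) * i + n)"
      using a u by (auto simp: u_pow rel2 simp flip: m_assoc nat_pow_mult)
    then show ?thesis unfolding S_def by blast
  qed
  have u_inv: "inv\<^bsub>?Q\<^esub> ?u = ?a [^]\<^bsub>?Q\<^esub> n \<otimes>\<^bsub>?Q\<^esub> ?u"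
  proof (rule inv_equality)
    have "?a [^]\<^bsub>?Q\<^esub> n \<otimes>\<^bsub>?Q\<^esub> ?u \<otimes>\<^bsub>?Q\<^esub> ?u = ?a [^]\<^bsub>?Q\<^esub> n \<otimes>\<^bsub>?Q\<^esub> ?a [^]\<^bsub>?Q\<^esub> n"
      using a u by (simp add: rel2 m_assoc)
    then show "?a [^]\<^bsub>?Q\<^esub> n \<otimes>\<^bsub>?Q\<^esub> ?u \<otimes>\<^bsub>?Q\<^esub> ?u = \<one>\<^bsub>?Q\<^esub>"
      using rel1 a by (simp add: nat_pow_mult mult_2)
  qed (use a u in simp_all)
  have "?c v \<in> S" for v
  proof (induction v)
    case Nil
    show ?case unfolding S_def one[symmetric] by (rule CollectI, rule exI[of _ 0]) simp
  next
    case (Cons l v)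
    have split: "?c (l # v) = ?c [l] \<otimes>\<^bsub>?Q\<^esub> ?c v" by (simp add: mult)
    obtain g e where l: "l = (g, e)" by force
    show ?case
    proof (cases g)
      case A
      have "?c [l] = ?a [^]\<^bsub>?Q\<^esub> (if e then 1 else 2 * n - 1 :: nat)"
        using a by (simp add: l A inverse_letter a_inv)
      then show ?thesis using S_pow[OF Cons.IH] by (simp only: split)
    next
      case U
      have "?c [l] = ?a [^]\<^bsub>?Q\<^esub> (if e then 0 else n) \<otimes>\<^bsub>?Q\<^esub> ?u"
        using u by (simp add: l U inverse_letter u_inv)
      moreover have "?c v \<in> carrier ?Q" by (simp add: carrier)
      ultimately show ?thesis using S_pow[OF S_u[OF Cons.IH]] a u by (simp only: split m_assoc nat_pow_closed)
    qed
  qed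
  then have gen: "\<exists>i::nat. w = ?a [^]\<^bsub>?Q\<^esub> i \<or> w = ?a [^]\<^bsub>?Q\<^esub> i \<otimes>\<^bsub>?Q\<^esub> ?u" if "w \<in> carrier ?Q" for w
    using that unfolding carrier S_def by blast
  let ?\<zeta> = "cyc_gen (2 * n)"
  have zn: "?\<zeta> ^ n = -1" using assms by (simp add: cyc_gen_pow)
  have z0: "?\<zeta> \<noteq> 0" by (simp add: cyc_gen_eq_cis)
  note same = word_eq_imp_same_action[OF _ zn z0, of _ _ "(1, 0)"]
  show ?thesis
  proof (rule generalized_quaternionI[OF _ a u assms rel2 rel3 _ _ gen])
    show "group ?Q" by (rule is_group)
    show "?a [^]\<^bsub>?Q\<^esub> i = \<one>\<^bsub>?Q\<^esub> \<longleftrightarrow> 2 * n dvd i" for i :: nat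
    proof
      assume "?a [^]\<^bsub>?Q\<^esub> i = \<one>\<^bsub>?Q\<^esub>"
      then have "word_eq ?R (replicate i (A, True)) []" by (simp add: a_pow one word_class_eq_iff)
      from same[OF this] show "2 * n dvd i"
        using assms cyc_gen_pow_eq_1_iff[of "2 * n" i] by (simp add: foldr_letter_action_replicate del: foldr_replicate)
    next
      assume "2 * n dvd i"
      then obtain k where "i = 2 * n * k" by blast
      then show "?a [^]\<^bsub>?Q\<^esub> i = \<one>\<^bsub>?Q\<^esub>" using nat_pow_pow[OF a, of "2 * n" k] rel1 by simp
    qed
    show "?u \<noteq> ?a [^]\<^bsub>?Q\<^esub> i" for i :: nat
    proof
      assume "?u = ?a [^]\<^bsub>?Q\<^esub> i"
      then have "word_eq ?R [(U, True)] (replicate i (A, True))" by (simp add: a_pow word_class_eq_iff)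
      from same[OF this] show False by (simp add: foldr_letter_action_replicate del: foldr_replicate)
    qed
  qed auto
qed

lemma minus_one_eq:
  assumes "0 < n"
  shows "minus_one n = word_class (quat_relations n) [(A, True)] [^]\<^bsub>gen_quat n\<^esub> n"
proof -
  interpret generalized_quaternion "gen_quat n" "word_class (quat_relations n) [(A, True)]" n
    using assms by (rule generalized_quaternion_gen_quat)
  have "minus_one n = m"
    unfolding minus_one_def
  proof (rule the_equality)
    fix z assume z: "z \<in> carrier (gen_quat n) \<and> ord z = 2"
    then have "z [^]\<^bsub>gen_quat n\<^esub> (2::nat) = \<one>\<^bsub>gen_quat n\<^esub>" "z \<noteq> \<one>\<^bsub>gen_quat n\<^esub>"
      by (auto simp: pow_eq_id)
    then show "z = m" using involution_eq_m z by blast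
  qed (simp add: ord_m)
  then show ?thesis by (simp add: m_def)
qed

section \<open>Arithmetic of the parameters\<close>

lemma rad_even_div_2:
  assumes "even n" "0 < n"
  shows "rad n div 2 = \<Prod>(prime_factors n - {2})"
proof -
  have "2 \<in> prime_factors n" using assms by (simp add: prime_factors_dvd two_is_prime_nat)
  then show ?thesis unfolding rad_def by (subst prod.remove[of _ 2]) simp_all
qed

lemma rad_le:
  assumes "0 < n"
  shows "rad n \<le> n"
proof -
  have "rad n = (\<Prod>p\<in>prime_factors n. p)" by (simp add: rad_def)
  also have "\<dots> \<le> (\<Prod>p\<in>prime_factors n. p ^ multiplicity p n)"
  proof (rule prod_mono)
    fix p assume "p \<in> prime_factors n"
    then have "prime p" "1 \<le> multiplicity p n"
      by (auto simp: prime_factors_multiplicity Suc_leI)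
    then show "0 \<le> p \<and> p \<le> p ^ multiplicity p n"
      using self_le_power[of p "multiplicity p n"] prime_ge_1_nat by auto
  qed
  also have "\<dots> = n" using assms by (rule prime_factorization_nat[symmetric])
  finally show ?thesis .
qed

text \<open>The congruence forces \<open>q > 2t\<close>, so that \<open>q\<^sup>4\<close> leaves ample room for the \<open>32t + r\<close> points of the action.\<close>

lemma degree_bound:
  fixes q t r :: nat
  assumes "prime q" "[q = 1] (mod 2 * t)" "6 \<le> t" "r \<le> t"
  shows "32 * t + r \<le> q ^ 4"
proof -
  have q: "1 < q" using assms(1) by (rule prime_gt_1_nat)
  then have "2 * t dvd q - 1"
    using assms(2) by (simp add: cong_altdef_nat)
  then have "2 * t \<le> q - 1" using q by (intro dvd_imp_le) simp_all
  then have "2 * t \<le> q" "12 \<le> q" using assms(3) by simp_all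
  have "12 ^ 3 * (2 * t) \<le> q ^ 3 * q"
    by (intro mult_le_mono power_mono) (use \<open>12 \<le> q\<close> \<open>2 * t \<le> q\<close> in simp_all)
  moreover have "q ^ 3 * q = q ^ 4" by (simp add: power_Suc2 eval_nat_numeral)
  ultimately show ?thesis using assms(4) by simp
qed

text \<open>For neighbouring \<open>\<alpha>\<close> and \<open>\<beta>\<close>, the odd one larger, the two quaternion groups have equally many square roots of
  \<open>-1\<close>. Both parts of the corollary are instances: \<open>(p, p - 1)\<close> and \<open>(2p, 2p + 1)\<close>, with \<open>d = p\<close>.\<close>

lemma gen_quat_product_property_Q:
  fixes d N r \<alpha> \<beta> :: nat
  assumes pos: "0 < \<alpha>" "0 < \<beta>" and neighbours: "odd \<alpha> \<and> \<alpha> = \<beta> + 1 \<or> odd \<beta> \<and> \<beta> = \<alpha> + 1"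
    and d: "prime d" "3 \<le> d" "d dvd \<alpha>" "coprime d \<beta>" "coprime d r" and r: "odd r"
    and small: "\<And>k. odd k \<Longrightarrow> k < d \<Longrightarrow> coprime k r \<Longrightarrow> coprime k \<alpha> \<and> coprime k \<beta>"
    and size: "32 * (\<alpha> * \<beta>) + r \<le> N"
  shows "\<exists>\<phi> \<in> mon (gen_quat \<alpha> \<times>\<times> gen_quat \<beta> \<times>\<times> cyc r) (sym_group N).
    property_Q (\<phi> ` carrier (gen_quat \<alpha> \<times>\<times> gen_quat \<beta> \<times>\<times> cyc r)) (sym_group N) (2 * d)
      (\<phi> (minus_one \<alpha>, \<one>\<^bsub>gen_quat \<beta>\<^esub>, cyc_gen r)) (\<phi> (\<one>\<^bsub>gen_quat \<alpha>\<^esub>, minus_one \<beta>, cyc_gen r))"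
proof -
  have r0: "0 < r" using r by (cases r) simp_all
  interpret G: generalized_quaternion "gen_quat \<alpha>" "word_class (quat_relations \<alpha>) [(A, True)]" \<alpha>
    by (rule generalized_quaternion_gen_quat[OF pos(1)])
  interpret H: generalized_quaternion "gen_quat \<beta>" "word_class (quat_relations \<beta>) [(A, True)]" \<beta>
    by (rule generalized_quaternion_gen_quat[OF pos(2)])
  have "card (roots (gen_quat \<alpha>) 2 G.m) = card (roots (gen_quat \<beta>) 2 H.m)"
    unfolding G.card_roots_2_m H.card_roots_2_m using neighbours by auto
  then show ?thesis
    unfolding minus_one_eq[OF pos(1)] minus_one_eq[OF pos(2)]
    using d r r0 small size prime_odd_nat[of d]
    by (intro quaternion_product_property_Q[OF G.generalized_quaternion_axioms H.generalized_quaternion_axioms group_cyc])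
       (auto simp: order_cyc ord_cyc_gen cyc_gen_pow_eq_1_iff squarefree_prime G.m_def H.m_def)
qed

theorem corollary3p18:
  fixes p :: nat
  assumes "prime p" and "p \<ge> 3"
  shows
    "(\<forall>q. prime q \<and> [q = 1] (mod 2 * p * (p - 1)) \<longrightarrow>
       (let r = rad (p - 1) div 2;
            G = gen_quat p \<times>\<times> gen_quat (p - 1) \<times>\<times> cyc r;
            x = (minus_one p, \<one>\<^bsub>gen_quat (p - 1)\<^esub>, cyc_gen r);
            y = (\<one>\<^bsub>gen_quat p\<^esub>, minus_one (p - 1), cyc_gen r)
        in \<exists>\<phi> \<in> mon G (sym_group (q ^ 4)).
             property_Q (\<phi> ` carrier G) (sym_group (q ^ 4)) (2 * p) (\<phi> x) (\<phi> y)))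
     \<and>
     (prime (2 * p + 1) \<longrightarrow>
       (\<forall>q'. prime q' \<and> [q' = 1] (mod 4 * p * (2 * p + 1)) \<longrightarrow>
         (let G' = gen_quat (2 * p + 1) \<times>\<times> gen_quat (2 * p);
              x' = (\<one>\<^bsub>gen_quat (2 * p + 1)\<^esub>, minus_one (2 * p));
              y' = (minus_one (2 * p + 1), \<one>\<^bsub>gen_quat (2 * p)\<^esub>)
          in \<exists>\<phi> \<in> mon G' (sym_group (q' ^ 4)).
               property_Q (\<phi> ` carrier G') (sym_group (q' ^ 4)) (2 * p) (\<phi> x') (\<phi> y'))))"
proof (intro conjI allI impI)
  have odd_p: "odd p" using assms prime_odd_nat by simp
  have coprime_p: "coprime k p" if "odd k" "k < p" for k
  proof -
    have "0 < k" using that(1) by (cases k) simp_all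
    then have "\<not> p dvd k" using that(2) by (auto dest: dvd_imp_le)
    then show ?thesis using prime_imp_coprime[OF assms(1)] by (simp add: coprime_commute)
  qed
  {
    fix q assume q: "prime q \<and> [q = 1] (mod 2 * p * (p - 1))"
    define r where "r = rad (p - 1) div 2"
    have p1: "even (p - 1)" "0 < p - 1" using odd_p assms(2) by simp_all
    have r_prod: "r = \<Prod>(prime_factors (p - 1) - {2})"
      unfolding r_def using p1 by (rule rad_even_div_2)
    have "odd r"
      unfolding r_prod by (auto simp: even_prod_iff in_prime_factors_iff dest: primes_dvd_imp_eq[OF two_is_prime_nat])
    have "coprime p r"
      unfolding r_prod
    proof (rule prod_coprime_right)
      fix s assume "s \<in> prime_factors (p - 1) - {2}"
      then have s: "prime s" "s dvd p - 1" by auto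
      then have "s < p" using p1(2) by (auto dest: dvd_imp_le)
      then show "coprime p s" using primes_coprime[OF assms(1) s(1)] by simp
    qed
    have coprime_pred: "coprime k (p - 1)" if "odd k" "coprime k r" for k
    proof (rule ccontr)
      assume "\<not> coprime k (p - 1)"
      then have "gcd k (p - 1) \<noteq> 1" by blast
      then obtain s where s: "prime s" "s dvd k" "s dvd p - 1"
        using prime_factor_nat by (meson gcd_greatest_iff dvd_refl)
      have "s \<noteq> 2" using s(2) that(1) by auto
      then have "s \<in> prime_factors (p - 1) - {2}" using s p1(2) by (simp add: in_prime_factors_iff)
      then have "s dvd r" unfolding r_prod by (intro dvd_prodI) simp_all
      then show False using s that(2) by (meson coprime_common_divisor not_prime_unit)
    qed
    have "r \<le> p * (p - 1)"
    proof -
      have "r \<le> p - 1" using rad_le[OF p1(2)] by (simp add: r_def)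
      also have "\<dots> \<le> p * (p - 1)" using assms(2) by simp
      finally show ?thesis .
    qed
    moreover have "6 \<le> p * (p - 1)"
      using mult_le_mono[of 3 p 2 "p - 1"] assms(2) by simp
    ultimately have "32 * (p * (p - 1)) + r \<le> q ^ 4"
      using q by (intro degree_bound) (simp_all add: mult.assoc)
    then have "\<exists>\<phi> \<in> mon (gen_quat p \<times>\<times> gen_quat (p - 1) \<times>\<times> cyc r) (sym_group (q ^ 4)).
      property_Q (\<phi> ` carrier (gen_quat p \<times>\<times> gen_quat (p - 1) \<times>\<times> cyc r)) (sym_group (q ^ 4)) (2 * p)
      (\<phi> (minus_one p, \<one>\<^bsub>gen_quat (p - 1)\<^esub>, cyc_gen r)) (\<phi> (\<one>\<^bsub>gen_quat p\<^esub>, minus_one (p - 1), cyc_gen r))"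
      using assms p1 odd_p \<open>odd r\<close> \<open>coprime p r\<close> coprime_p coprime_pred coprime_diff_one_right_nat[of p]
      by (intro gen_quat_product_property_Q) simp_all
    then show "let r = rad (p - 1) div 2;
            G = gen_quat p \<times>\<times> gen_quat (p - 1) \<times>\<times> cyc r;
            x = (minus_one p, \<one>\<^bsub>gen_quat (p - 1)\<^esub>, cyc_gen r);
            y = (\<one>\<^bsub>gen_quat p\<^esub>, minus_one (p - 1), cyc_gen r)
        in \<exists>\<phi> \<in> mon G (sym_group (q ^ 4)).
             property_Q (\<phi> ` carrier G) (sym_group (q ^ 4)) (2 * p) (\<phi> x) (\<phi> y)"
      unfolding Let_def r_def .
  }
  fix q' assume prime_s: "prime (2 * p + 1)" and q': "prime q' \<and> [q' = 1] (mod 4 * p * (2 * p + 1))"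
  let ?Q = "gen_quat (2 * p)" and ?R = "gen_quat (2 * p + 1)" and ?N = "sym_group (q' ^ 4)"
  let ?P = "?Q \<times>\<times> ?R \<times>\<times> cyc 1"
  have "6 \<le> 2 * p * (2 * p + 1)"
    using mult_le_mono[of 6 "2 * p" 1 "2 * p + 1"] assms(2) by simp
  then have "32 * (2 * p * (2 * p + 1)) + 1 \<le> q' ^ 4"
    using q' by (intro degree_bound) (simp_all add: mult.assoc)
  moreover have "coprime k (2 * p + 1)" if "odd k" "k < p" for k
  proof -
    have "0 < k" using that(1) by (cases k) simp_all
    then have "\<not> 2 * p + 1 dvd k" using that(2) by (auto dest: dvd_imp_le)
    then show ?thesis using prime_imp_coprime[OF prime_s] by (simp add: coprime_commute)
  qed
  moreover have "coprime p (2 * p + 1)"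
    by (metis coprime_Suc_right_nat coprime_mult_right_iff Suc_eq_plus1 coprime_commute)
  ultimately obtain \<phi> where \<phi>: "\<phi> \<in> mon ?P ?N"
    and Q: "property_Q (\<phi> ` carrier ?P) ?N (2 * p)
      (\<phi> (minus_one (2 * p), \<one>\<^bsub>?R\<^esub>, cyc_gen 1)) (\<phi> (\<one>\<^bsub>?Q\<^esub>, minus_one (2 * p + 1), cyc_gen 1))"
    using gen_quat_product_property_Q[of "2 * p" "2 * p + 1" p 1 "q' ^ 4"] assms coprime_p by auto
  \<comment> \<open>The factor that \<open>p\<close> divides has to come first, and a trivial cyclic factor is appended.\<close>
  define \<psi> where "\<psi> = (\<lambda>(g :: quat_gen word set, h :: quat_gen word set). (h, g, 1 :: complex))"
  have \<psi>: "\<psi> \<in> mon (?R \<times>\<times> ?Q) ?P"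
    by (auto simp: mon_def hom_def inj_on_def \<psi>_def)
  have \<psi>_app: "\<psi> (g, h) = (h, g, 1)" for g h by (simp add: \<psi>_def)
  have gen_1: "cyc_gen 1 = 1" by (simp add: cyc_gen_eq_cis)
  have img: "(\<phi> \<circ> \<psi>) ` carrier (?R \<times>\<times> ?Q) = \<phi> ` carrier ?P"
  proof -
    have "\<psi> ` carrier (?R \<times>\<times> ?Q) = carrier ?P" by (auto simp: \<psi>_def)
    then show ?thesis by (simp only: image_comp[symmetric])
  qed
  have "property_Q ((\<phi> \<circ> \<psi>) ` carrier (?R \<times>\<times> ?Q)) ?N (2 * p)
      ((\<phi> \<circ> \<psi>) (\<one>\<^bsub>?R\<^esub>, minus_one (2 * p))) ((\<phi> \<circ> \<psi>) (minus_one (2 * p + 1), \<one>\<^bsub>?Q\<^esub>))"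
    unfolding img o_apply \<psi>_app using Q[unfolded gen_1] .
  moreover have "\<phi> \<circ> \<psi> \<in> mon (?R \<times>\<times> ?Q) ?N" using \<psi> \<phi> by (rule mon_compose)
  ultimately show "let G' = ?R \<times>\<times> ?Q;
              x' = (\<one>\<^bsub>?R\<^esub>, minus_one (2 * p));
              y' = (minus_one (2 * p + 1), \<one>\<^bsub>?Q\<^esub>)
          in \<exists>\<phi> \<in> mon G' (sym_group (q' ^ 4)).
               property_Q (\<phi> ` carrier G') (sym_group (q' ^ 4)) (2 * p) (\<phi> x') (\<phi> y')"
    unfolding Let_def by blast
qed

end
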